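(* Let $u:\mathbb{R}^2\to\mathbb{R}$ be continuous, and let the payoffs $X_1,\dots,X_K$ of the $K$ arms have finite means $\mu_k$ and finite variances $\sigma_k^2\ge0$. Suppose there exist $g\ge1$ and a constant $c>0$ such that $|u(x,y)|\le c\,(1+\|(x,y)\|^{g-1})$ for all $(x,y)\in\mathbb{R}^2$, and $\sup_{1\le k\le K}E_P[|X_k|^g]<\infty$. Let $\overline\mu=\max_k\mu_k$ and $\underline\sigma^2=\min_k\sigma_k^2$. If $u(x,y)$ is increasing in $x$ and concave in $y$, and if $(\overline\mu,\underline\sigma^2)\in\mathcal{A}$, then the strategy of always choosing (at every stage and history) an arm with mean-variance pair $(\overline\mu,\underline\sigma^2)$ is asymptotically optimal, and the limiting value is $$V=\int u(\overline\mu,\cdot)\,d\mathbb{N}(0,\underline\sigma^2).$$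
   Context: Setting. $(\Omega,\mathcal{F},P)$ is a probability space on which all random variables are defined. There are $K$ arms. Arm $k$ has random payoff $X_k$ with mean $\mu_k=E_P[X_k]$ and variance $\sigma_k^2=Var_P[X_k]$; $\{X_{k,n}:n\ge1\}$ are i.i.d. copies of $X_k$, and payoffs are independent across arms and across stages. The set of mean-variance pairs is $\mathcal{A}=\{(\mu_k,\sigma_k^2):1\le k\le K\}$. A strategy $\theta=(\theta_1,\theta_2,\dots)$ is a sequence of $\{1,\dots,K\}$-valued random variables; the reward at stage $n$ is $Z_n^\theta=X_{k,n}$ on $\{\theta_n=k\}$. Let $\mathcal{H}_0^\theta=\{\emptyset,\Omega\}$ and $\mathcal{H}_{n-1}^\theta=\sigma\{Z_1^\theta,\dots,Z_{n-1}^\theta,\theta_1,\dots,\theta_{n-1}\}$ for $n>1$. $\theta$ is admissible if $\theta_n$ is $\mathcal{H}_{n-1}^\theta$-measurable for all $n\ge1$; $\Theta$ is the set of admissible strategies. For horizon $n$, the expected utility of $\theta$ is $$U_n(\theta)=E_P\Big[u\Big(\tfrac1n\sum_{i=1}^nZ_i^\theta,\ \tfrac1{\sqrt n}\sum_{i=1}^n\big(Z_i^\theta-E_P[Z_i^\theta\mid\mathcal{H}_{i-1}^\theta]\big)\Big)\Big].$$ Let $V_n=\sup_{\theta\in\Theta}U_n(\theta)$ and $V=\lim_{n\to\infty}V_n$ (the limit exists under the stated assumptions). A strategy $\theta^*\in\Theta$ is asymptotically optimal if $\lim_{n\to\infty}U_n(\theta^* )=V$. $\mathbb{N}(0,\sigma^2)$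 is the normal distribution with mean $0$ and variance $\sigma^2$ (the Dirac mass at $0$ if $\sigma=0$). *)

theory Defs
  imports "HOL-Probability.Probability"
begin

text \<open>
  Arms are the indices \<open>1, \<dots>, K\<close> and stages are the indices \<open>n \<ge> 1\<close>: \<open>X k\<close> is the generic payoff
  of arm \<open>k\<close>, and \<open>Y k n\<close> is the copy of it that is drawn at stage \<open>n\<close>. A strategy \<open>\<theta>\<close> maps a stage
  and an outcome to an arm; its value at stage \<open>0\<close> is never used.
\<close>

definition arm_mean :: "'a measure \<Rightarrow> (nat \<Rightarrow> 'a \<Rightarrow> real) \<Rightarrow> nat \<Rightarrow> real" where
  "arm_mean M X k = prob_space.expectation M (X k)"

definition arm_var :: "'a measure \<Rightarrow> (nat \<Rightarrow> 'a \<Rightarrow> real) \<Rightarrow> nat \<Rightarrow> real" where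
  "arm_var M X k = prob_space.variance M (X k)"

definition mean_var_pairs :: "'a measure \<Rightarrow> nat \<Rightarrow> (nat \<Rightarrow> 'a \<Rightarrow> real) \<Rightarrow> (real \<times> real) set" where
  "mean_var_pairs M K X = (\<lambda>k. (arm_mean M X k, arm_var M X k)) ` {1..K}"

definition reward :: "(nat \<Rightarrow> nat \<Rightarrow> 'a \<Rightarrow> real) \<Rightarrow> (nat \<Rightarrow> 'a \<Rightarrow> nat) \<Rightarrow> nat \<Rightarrow> 'a \<Rightarrow> real" where
  "reward Y \<theta> n \<omega> = Y (\<theta> n \<omega>) n \<omega>"

text \<open>
  \<open>history M Y \<theta> m\<close> is the \<open>\<sigma>\<close>-algebra generated by the rewards and the choices of the stages
  \<open>1, \<dots>, m\<close>; it is trivial for \<open>m = 0\<close>. Only its space and its sets are relevant.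
\<close>

definition history ::
    "'a measure \<Rightarrow> (nat \<Rightarrow> nat \<Rightarrow> 'a \<Rightarrow> real) \<Rightarrow> (nat \<Rightarrow> 'a \<Rightarrow> nat) \<Rightarrow> nat \<Rightarrow> 'a measure" where
  "history M Y \<theta> m = sigma (space M)
     ((\<Union>i\<in>{1..m}. {reward Y \<theta> i -` B \<inter> space M | B. B \<in> sets (borel :: real measure)}) \<union>
      (\<Union>i\<in>{1..m}. {\<theta> i -` B \<inter> space M | B. B \<in> sets (count_space (UNIV :: nat set))}))"

definition admissible_strategies ::
    "'a measure \<Rightarrow> nat \<Rightarrow> (nat \<Rightarrow> nat \<Rightarrow> 'a \<Rightarrow> real) \<Rightarrow> (nat \<Rightarrow> 'a \<Rightarrow> nat) set" where
  "admissible_strategies M K Y =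
     {\<theta>. (\<forall>n\<ge>1. \<theta> n \<in> M \<rightarrow>\<^sub>M count_space {1..K}) \<and>
         (\<forall>n\<ge>1. \<theta> n \<in> history M Y \<theta> (n - 1) \<rightarrow>\<^sub>M count_space {1..K})}"

definition expected_utility ::
    "'a measure \<Rightarrow> (nat \<Rightarrow> nat \<Rightarrow> 'a \<Rightarrow> real) \<Rightarrow> (real \<times> real \<Rightarrow> real) \<Rightarrow> nat \<Rightarrow>
     (nat \<Rightarrow> 'a \<Rightarrow> nat) \<Rightarrow> real" where
  "expected_utility M Y u n \<theta> = prob_space.expectation M (\<lambda>\<omega>.
     u (1 / real n * (\<Sum>i=1..n. reward Y \<theta> i \<omega>),
        1 / sqrt (real n) * (\<Sum>i=1..n. reward Y \<theta> i \<omega>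
            - real_cond_exp M (history M Y \<theta> (i - 1)) (reward Y \<theta> i) \<omega>)))"

text \<open>The supremum is taken in the extended reals, so that no boundedness has to be presupposed.\<close>

definition horizon_value ::
    "'a measure \<Rightarrow> nat \<Rightarrow> (nat \<Rightarrow> nat \<Rightarrow> 'a \<Rightarrow> real) \<Rightarrow> (real \<times> real \<Rightarrow> real) \<Rightarrow> nat \<Rightarrow> ereal" where
  "horizon_value M K Y u n =
     (SUP \<theta>\<in>admissible_strategies M K Y. ereal (expected_utility M Y u n \<theta>))"

definition limit_value ::
    "'a measure \<Rightarrow> nat \<Rightarrow> (nat \<Rightarrow> nat \<Rightarrow> 'a \<Rightarrow> real) \<Rightarrow> (real \<times> real \<Rightarrow> real) \<Rightarrow> ereal" where
  "limit_value M K Y u = lim (\<lambda>n. horizon_value M K Y u n)"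

definition asymptotically_optimal ::
    "'a measure \<Rightarrow> nat \<Rightarrow> (nat \<Rightarrow> nat \<Rightarrow> 'a \<Rightarrow> real) \<Rightarrow> (real \<times> real \<Rightarrow> real) \<Rightarrow>
     (nat \<Rightarrow> 'a \<Rightarrow> nat) \<Rightarrow> bool" where
  "asymptotically_optimal M K Y u \<theta> \<longleftrightarrow>
     \<theta> \<in> admissible_strategies M K Y \<and>
     (\<lambda>n. ereal (expected_utility M Y u n \<theta>)) \<longlonglongrightarrow> limit_value M K Y u"

text \<open>
  The parameter is the variance, whereas \<open>normal_density\<close> takes the standard deviation. At standard
  deviation \<open>0\<close> that density is constantly \<open>0\<close>, hence the separate case.
\<close>

definition centred_normal :: "real \<Rightarrow> real measure" where
  "centred_normal v =
     (if v = 0 then return borel 0 else density lborel (normal_density 0 (sqrt v)))"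

end

theory Submission
  imports Defs
begin

text \<open>
  By monotonicity of \<open>u\<close> in the first argument, the utility of a strategy \<open>\<theta>\<close> is at most the
  expectation of \<open>u (\<mu>_max + W / sqrt n, W)\<close>, where \<open>W\<close> is \<open>1 / sqrt n\<close> times a martingale whose
  increments have conditional variances at least \<open>\<sigma>2_min\<close>. The moments \<open>E (1 + W\<^sup>2) powr q\<close> with
  \<open>2 * q = max g 2\<close> are bounded uniformly in \<open>n\<close> and \<open>\<theta>\<close>, while \<open>u\<close> grows at most like
  \<open>(1 + W\<^sup>2) powr (q - 1/2)\<close>. Hence tails are uniformly negligible, the drift \<open>W / sqrt n\<close> can be
  dropped, and the concave function \<open>u (\<mu>_max, \<cdot>)\<close> can be replaced by a concave \<open>g\<close> with bounded
  Lipschitz second derivative. Exchanging the stages one at a time for an optimal arm changes the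
  expectation of \<open>g W\<close> by \<open>E g'' (\<sigma>\<^sup>2 - \<sigma>2_min) / (2 * n) \<le> 0\<close> per stage, up to \<open>o(1 / n)\<close>. This leaves the
  i.i.d. case, which is the central limit theorem.
\<close>

subsection \<open>Second-order expansions and concave approximation\<close>

text \<open>A strategy may react to everything seen so far, so the normalized sum has neither
  independent increments nor a fixed limit law. Two facts survive: the copies of a stage are
  independent of the choice made there, and the conditional variance is that of the chosen arm. A
  concave test function has second derivative at most 0 everywhere, so every exchange has the same
  sign whatever the history; no dynamic programming is needed. The order of the exchanges matters:
  choices after a stage may depend on its payoff, and they stop doing so once they are the fixed
  arm. Concavity alone gives neither second derivatives nor control far out. Tangents at points of a
  bounded interval first make the function Lipschitz, then averaging makes it smooth; the growth
  constant must not depend on the interval, because the interval is chosen from that constant. The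
  order \<open>max g 2\<close> appears because finite variances supply order 2 even for small
  \<open>g\<close>, while \<open>u\<close> grows one order less than the payoffs are integrable.
  That missing order is the half power of \<open>1 + W\<^sup>2\<close> that makes the tails
  small.\<close>

lemma second_order_taylor:
  fixes f f1 f2 :: "real \<Rightarrow> real"
  assumes f: "\<And>x. (f has_real_derivative f1 x) (at x)"
    and f1: "\<And>x. (f1 has_real_derivative f2 x) (at x)"
  obtains \<xi> where "\<bar>\<xi> - x\<bar> \<le> \<bar>d\<bar>" "f (x + d) = f x + f1 x * d + f2 \<xi> * d\<^sup>2 / 2"
proof (cases "d = 0")
  case True
  then show ?thesis using that[of x] by simp
next
  case False
  define D where "D n = (if n = 0 then f else if n = Suc 0 then f1 else f2)" for n
  have "\<exists>t. (if x + d < x then x + d < t \<and> t < x else x < t \<and> t < x + d) \<and>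
      f (x + d) = (\<Sum>m<2. (D m x / fact m) * (x + d - x) ^ m) + (D 2 t / fact 2) * (x + d - x) ^ 2"
  proof (rule Taylor[where a = "min x (x + d)" and b = "max x (x + d)"])
    show "\<forall>m t. m < 2 \<and> min x (x + d) \<le> t \<and> t \<le> max x (x + d) \<longrightarrow> DERIV (D m) t :> D (Suc m) t"
      using f f1 by (auto simp: D_def less_2_cases_iff)
  qed (use False in \<open>auto simp: D_def\<close>)
  then obtain t where t: "if x + d < x then x + d < t \<and> t < x else x < t \<and> t < x + d"
    and eq: "f (x + d) = (\<Sum>m<2. (D m x / fact m) * (x + d - x) ^ m) + (D 2 t / fact 2) * (x + d - x) ^ 2"
    by blast
  show ?thesis
  proof (rule that[of t])
    show "\<bar>t - x\<bar> \<le> \<bar>d\<bar>" using t by (auto split: if_splits)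
    show "f (x + d) = f x + f1 x * d + f2 t * d\<^sup>2 / 2"
      using eq by (simp add: D_def numeral_2_eq_2)
  qed
qed

text \<open>Prepares a Gronwall recursion for moments. The linear term has a coefficient depending
  on \<open>x\<close> alone, so it vanishes against a centred increment; the remainder is a function
  of \<open>x\<close> times a function of \<open>d\<close>, so independence splits its expectation.
  The factor in \<open>x\<close> is the starting power itself, which closes the recursion.\<close>

lemma one_plus_square_powr_increment:
  fixes q :: real
  assumes "q \<ge> 1"
  obtains C g where "C \<ge> 0" "continuous_on UNIV g" "\<And>x. \<bar>g x\<bar> \<le> C * (1 + x\<^sup>2) powr q"
    "\<And>x d. (1 + (x + d)\<^sup>2) powr q
       \<le> (1 + x\<^sup>2) powr q + g x * d + C * (1 + x\<^sup>2) powr q * ((1 + d\<^sup>2) powr (q - 1) * d\<^sup>2)"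
proof -
  define f where "f x = (1 + x\<^sup>2) powr q" for x :: real
  define f1 where "f1 x = 2 * q * x * (1 + x\<^sup>2) powr (q - 1)" for x :: real
  define f2 where "f2 x = 2 * q * (1 + x\<^sup>2) powr (q - 1) + 4 * q * (q - 1) * x\<^sup>2 * (1 + x\<^sup>2) powr (q - 2)" for x :: real
  define A where "A = 2 * q + 4 * q * (q - 1)"
  \<comment> \<open>\<open>A\<close> times the power \<open>q - 1\<close> bounds the second
    derivative. The factor \<open>2 powr (q - 1)\<close> pays for replacing the intermediate point
    \<open>z\<close> by \<open>x\<close>, through
    \<open>1 + z\<^sup>2 \<le> 2 * (1 + x\<^sup>2) * (1 + d\<^sup>2)\<close>.\<close>
  define C where "C = A * 2 powr (q - 1)"
  have pos [simp]: "0 < 1 + x\<^sup>2" for x :: real by (simp add: add_pos_nonneg)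
  have df: "(f has_real_derivative f1 x) (at x)" for x
    unfolding f_def f1_def by (rule derivative_eq_intros refl pos | simp)+
  have df1: "(f1 has_real_derivative f2 x) (at x)" for x
    unfolding f1_def f2_def
    by (rule derivative_eq_intros refl pos | simp)+ (simp add: power2_eq_square algebra_simps)
  have A1: "A \<ge> 2 * q" using assms by (simp add: A_def)
  then have "A \<ge> 2" using assms by simp
  note A = A1 this
  have "(1::real) \<le> 2 powr (q - 1)" using assms by (intro ge_one_powr_ge_zero) auto
  then have C: "C \<ge> A" unfolding C_def using A by (simp add: mult_le_cancel_left1)
  have f2: "f2 x \<le> A * (1 + x\<^sup>2) powr (q - 1)" for x
  proof -
    have "x\<^sup>2 * (1 + x\<^sup>2) powr (q - 2) \<le> (1 + x\<^sup>2) * (1 + x\<^sup>2) powr (q - 2)"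
      by (intro mult_right_mono) auto
    also have "\<dots> = (1 + x\<^sup>2) powr (q - 1)"
      by (simp add: powr_mult_base)
    finally have "4 * q * (q - 1) * (x\<^sup>2 * (1 + x\<^sup>2) powr (q - 2)) \<le> 4 * q * (q - 1) * (1 + x\<^sup>2) powr (q - 1)"
      using assms by (intro mult_left_mono) auto
    then show ?thesis by (simp add: f2_def A_def algebra_simps)
  qed
  have le_f: "(1 + x\<^sup>2) powr (q - 1) \<le> (1 + x\<^sup>2) powr q" for x :: real
    by (intro powr_mono) auto
  show thesis
  proof (rule that[of C f1])
    show "0 \<le> C" using A C by simp
    show "continuous_on UNIV f1"
      using df1 by (intro continuous_at_imp_continuous_on) (auto intro: DERIV_isCont)
    show "\<bar>f1 x\<bar> \<le> C * (1 + x\<^sup>2) powr q" for x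
    proof -
      have "\<bar>x\<bar> \<le> 1 + x\<^sup>2"
        using sum_squares_bound[of 1 "\<bar>x\<bar>"] by (simp add: power2_eq_square)
      then have "\<bar>x\<bar> * (1 + x\<^sup>2) powr (q - 1) \<le> (1 + x\<^sup>2) * (1 + x\<^sup>2) powr (q - 1)"
        by (intro mult_right_mono) auto
      also have "\<dots> = (1 + x\<^sup>2) powr q" by (simp add: powr_mult_base)
      finally have "2 * q * (\<bar>x\<bar> * (1 + x\<^sup>2) powr (q - 1)) \<le> C * (1 + x\<^sup>2) powr q"
        using A C assms by (intro mult_mono) auto
      then show ?thesis using assms by (simp add: f1_def abs_mult algebra_simps)
    qed
    show "(1 + (x + d)\<^sup>2) powr q
       \<le> (1 + x\<^sup>2) powr q + f1 x * d + C * (1 + x\<^sup>2) powr q * ((1 + d\<^sup>2) powr (q - 1) * d\<^sup>2)" for x d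
    proof -
      obtain z where z: "\<bar>z - x\<bar> \<le> \<bar>d\<bar>" "f (x + d) = f x + f1 x * d + f2 z * d\<^sup>2 / 2"
        using second_order_taylor[OF df df1, of x d] by blast
      have "(z - x)\<^sup>2 \<le> d\<^sup>2" using z(1) by (metis abs_le_square_iff)
      moreover have "z\<^sup>2 \<le> 2 * x\<^sup>2 + 2 * (z - x)\<^sup>2"
        using zero_le_power2[of "z - 2 * x"] by (simp add: power2_eq_square algebra_simps)
      moreover have "2 * (1 + x\<^sup>2) * (1 + d\<^sup>2) = 2 + 2 * x\<^sup>2 + 2 * d\<^sup>2 + 2 * (x\<^sup>2 * d\<^sup>2)"
        by (simp add: algebra_simps)
      moreover have "0 \<le> x\<^sup>2 * d\<^sup>2" by simp
      ultimately have "1 + z\<^sup>2 \<le> 2 * (1 + x\<^sup>2) * (1 + d\<^sup>2)"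
        by linarith
      then have "(1 + z\<^sup>2) powr (q - 1) \<le> (2 * (1 + x\<^sup>2) * (1 + d\<^sup>2)) powr (q - 1)"
        using assms by (intro powr_mono2) auto
      also have "\<dots> = 2 powr (q - 1) * (1 + x\<^sup>2) powr (q - 1) * (1 + d\<^sup>2) powr (q - 1)"
        by (subst powr_mult)+ (simp_all add: pos[THEN less_imp_le])
      also have "\<dots> \<le> 2 powr (q - 1) * (1 + x\<^sup>2) powr q * (1 + d\<^sup>2) powr (q - 1)"
        by (intro mult_left_mono mult_right_mono le_f) auto
      finally have "A * (1 + z\<^sup>2) powr (q - 1) \<le> A * (2 powr (q - 1) * (1 + x\<^sup>2) powr q * (1 + d\<^sup>2) powr (q - 1))"
        using A by (intro mult_left_mono) auto
      then have f2z: "f2 z \<le> C * (1 + x\<^sup>2) powr q * (1 + d\<^sup>2) powr (q - 1)"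
        using f2[of z] by (simp only: C_def mult.assoc)
      have half: "a / 2 \<le> a" if "0 \<le> a" for a :: real using that by simp
      have nn: "0 \<le> C * (1 + x\<^sup>2) powr q * (1 + d\<^sup>2) powr (q - 1)"
        using A C by simp
      have "f2 z * d\<^sup>2 / 2 \<le> C * (1 + x\<^sup>2) powr q * (1 + d\<^sup>2) powr (q - 1) * d\<^sup>2 / 2"
        using f2z by (intro divide_right_mono mult_right_mono) auto
      also have "\<dots> \<le> C * (1 + x\<^sup>2) powr q * (1 + d\<^sup>2) powr (q - 1) * d\<^sup>2"
        using half[OF mult_nonneg_nonneg[OF nn zero_le_power2[of d]]] .
      finally show ?thesis using z(2) by (simp only: f_def mult.assoc)
    qed
  qed
qed

section \<open>Lipschitz truncation and smoothing of concave functions\<close>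

lemma continuous_antiderivative:
  fixes f :: "real \<Rightarrow> real"
  assumes "continuous_on UNIV f"
  obtains F where "\<And>x. (F has_real_derivative f x) (at x)"
proof -
  have "\<exists>F. \<forall>x. (-\<infinity>) < ereal x \<longrightarrow> ereal x < \<infinity> \<longrightarrow> (F has_vector_derivative f x) (at x)"
    using assms by (intro einterval_antiderivative) (auto simp: continuous_on_eq_continuous_at)
  then show ?thesis
    using that by (auto simp: has_real_derivative_iff_has_vector_derivative)
qed

text \<open>The smooth function is the second difference quotient of a double antiderivative of
  \<open>f\<close>, that is, \<open>f\<close> averaged against a triangular kernel on an interval of
  length \<open>2 * \<delta>\<close>. Its second derivative is the second difference quotient of
  \<open>f\<close> itself: concavity gives the sign and the Lipschitz property the bounds, without
  any differentiability of \<open>f\<close>.\<close>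

lemma lipschitz_concave_smoothing:
  fixes f :: "real \<Rightarrow> real"
  assumes lip: "\<And>x y. \<bar>f x - f y\<bar> \<le> L * \<bar>x - y\<bar>"
    and conc: "concave_on UNIV f" and "\<delta> > 0"
  obtains g g1 g2 B where "\<And>x. (g has_real_derivative g1 x) (at x)"
    "\<And>x. (g1 has_real_derivative g2 x) (at x)" "\<And>x. \<bar>g1 x\<bar> \<le> L" "\<And>x. g2 x \<le> 0"
    "\<And>x. \<bar>g2 x\<bar> \<le> B" "\<And>x y. \<bar>g2 x - g2 y\<bar> \<le> B * \<bar>x - y\<bar>" "\<And>x. \<bar>g x - f x\<bar> \<le> 2 * \<delta> * L"
proof -
  have L: "L \<ge> 0" using lip[of 0 1] by simp
  have cont: "continuous_on UNIV f"
  proof (rule continuous_on_subset[OF lipschitz_on_continuous_on])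
    show "L-lipschitz_on UNIV f" using lip L by (auto simp: lipschitz_on_def dist_real_def)
  qed simp
  obtain F where F: "\<And>x. (F has_real_derivative f x) (at x)"
    using continuous_antiderivative[OF cont] by blast
  then have "continuous_on UNIV F" by (auto intro: DERIV_isCont continuous_at_imp_continuous_on)
  then obtain G where G: "\<And>x. (G has_real_derivative F x) (at x)"
    using continuous_antiderivative by blast
  define D :: "(real \<Rightarrow> real) \<Rightarrow> real \<Rightarrow> real"
    where "D h x = (h (x + 2 * \<delta>) - 2 * h (x + \<delta>) + h x) / \<delta>\<^sup>2" for h x
  have DD: "(D H has_real_derivative D h x) (at x)"
    if H: "\<And>x. (H has_real_derivative h x) (at x)" for H h x
  proof -
    have "((\<lambda>x. H (x + c)) has_real_derivative h (x + c)) (at x)" for c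
      using H by (simp flip: DERIV_shift)
    then show ?thesis unfolding D_def
      by (intro DERIV_cdivide DERIV_add DERIV_diff DERIV_cmult H) auto
  qed
  define H where "H x = F (x + \<delta>) - F x" for x
  have H: "(H has_real_derivative (f (x + \<delta>) - f x)) (at x)" for x
    unfolding H_def by (intro DERIV_diff F) (simp flip: DERIV_shift add: F)
  show thesis
  \<comment> \<open>The first constant bounds \<open>D f\<close>, the second is a Lipschitz constant
    of it; one \<open>B\<close> has to serve both.\<close>
  proof (rule that[of "D G" "D F" "D f" "max (2 * L / \<delta>) (4 * L / \<delta>\<^sup>2)"])
    show "(D G has_real_derivative D F x) (at x)" for x by (rule DD[OF G])
    show "(D F has_real_derivative D f x) (at x)" for x by (rule DD[OF F])
    show "\<bar>D F x\<bar> \<le> L" for x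
    proof -
      obtain z where z: "H (x + \<delta>) - H x = \<delta> * (f (z + \<delta>) - f z)"
        using MVT2[of x "x + \<delta>" H "\<lambda>x. f (x + \<delta>) - f x"] H \<open>\<delta> > 0\<close> by auto
      have "F (x + 2 * \<delta>) - 2 * F (x + \<delta>) + F x = \<delta> * (f (z + \<delta>) - f z)"
        using z by (simp add: H_def algebra_simps)
      then have "D F x = (f (z + \<delta>) - f z) / \<delta>"
        unfolding D_def using \<open>\<delta> > 0\<close> by (simp add: power2_eq_square)
      also have "\<bar>\<dots>\<bar> \<le> L"
        using lip[of "z + \<delta>" z] \<open>\<delta> > 0\<close> by (simp add: field_simps)
      finally show ?thesis .
    qed
    show "D f x \<le> 0" for x
    proof -
      have "- f ((1 - 1/2) *\<^sub>R x + (1/2) *\<^sub>R (x + 2 * \<delta>)) \<le> (1 - 1/2) * - f x + (1/2) * - f (x + 2 * \<delta>)"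
        by (rule convex_onD[OF conc[unfolded concave_on_def]]) auto
      moreover have "(1 - 1/2) *\<^sub>R x + (1/2) *\<^sub>R (x + 2 * \<delta>) = x + \<delta>" by (simp add: field_simps)
      ultimately show ?thesis unfolding D_def
        by (intro divide_nonpos_pos) (use \<open>\<delta> > 0\<close> in auto)
    qed
    show "\<bar>D f x\<bar> \<le> max (2 * L / \<delta>) (4 * L / \<delta>\<^sup>2)" for x
    proof -
      have "\<bar>f (x + 2 * \<delta>) - 2 * f (x + \<delta>) + f x\<bar> \<le> 2 * L * \<delta>"
        using lip[of "x + 2 * \<delta>" "x + \<delta>"] lip[of "x + \<delta>" x] \<open>\<delta> > 0\<close> by (auto simp: abs_le_iff)
      then have "\<bar>D f x\<bar> \<le> 2 * L * \<delta> / \<delta>\<^sup>2"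
        by (simp add: D_def divide_right_mono)
      then show ?thesis using \<open>\<delta> > 0\<close> by (simp add: power2_eq_square)
    qed
    show "\<bar>D f x - D f y\<bar> \<le> max (2 * L / \<delta>) (4 * L / \<delta>\<^sup>2) * \<bar>x - y\<bar>" for x y
    proof -
      have "\<bar>(f (x + 2 * \<delta>) - 2 * f (x + \<delta>) + f x) - (f (y + 2 * \<delta>) - 2 * f (y + \<delta>) + f y)\<bar>
          \<le> 4 * L * \<bar>x - y\<bar>"
        using lip[of "x + 2 * \<delta>" "y + 2 * \<delta>"] lip[of "x + \<delta>" "y + \<delta>"] lip[of x y] by (simp add: abs_le_iff)
      then have "\<bar>D f x - D f y\<bar> \<le> 4 * L * \<bar>x - y\<bar> / \<delta>\<^sup>2"
        by (simp add: D_def divide_right_mono flip: diff_divide_distrib)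
      also have "\<dots> = 4 * L / \<delta>\<^sup>2 * \<bar>x - y\<bar>" by simp
      also have "\<dots> \<le> max (2 * L / \<delta>) (4 * L / \<delta>\<^sup>2) * \<bar>x - y\<bar>" by (intro mult_right_mono) auto
      finally show ?thesis .
    qed
    show "\<bar>D G x - f x\<bar> \<le> 2 * \<delta> * L" for x
    proof -
      have dG: "((\<lambda>x. G (x + \<delta>) - G x) has_real_derivative H x) (at x)" for x
        unfolding H_def by (intro DERIV_diff G) (simp flip: DERIV_shift add: G)
      \<comment> \<open>Two mean value theorems identify the smoothed value with \<open>f w\<close>
        for some \<open>w\<close> between \<open>x\<close> and
        \<open>x + 2 * \<delta>\<close>.\<close>
      obtain z where z: "x < z" "z < x + \<delta>"
        "(G (x + \<delta> + \<delta>) - G (x + \<delta>)) - (G (x + \<delta>) - G x) = \<delta> * H z"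
        using MVT2[of x "x + \<delta>" "\<lambda>x. G (x + \<delta>) - G x" H] dG \<open>\<delta> > 0\<close> by auto
      obtain w where w: "z < w" "w < z + \<delta>" "H z = \<delta> * f w"
        using MVT2[of z "z + \<delta>" F f] F \<open>\<delta> > 0\<close> by (auto simp: H_def)
      have "G (x + 2 * \<delta>) - 2 * G (x + \<delta>) + G x = \<delta> * (\<delta> * f w)"
        using z(3) w(3) by (simp add: algebra_simps)
      then have "D G x = f w"
        unfolding D_def using \<open>\<delta> > 0\<close> by (simp add: power2_eq_square)
      moreover have "L * \<bar>w - x\<bar> \<le> L * (2 * \<delta>)"
        using z w L by (intro mult_left_mono) auto
      ultimately show ?thesis using lip[of w x] by (simp add: mult_ac)
    qed
  qed
qed

lemma concave_supergradient:
  fixes f :: "real \<Rightarrow> real"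
  assumes "concave_on UNIV f"
  obtains s where "\<And>y. f y \<le> f x + s * (y - x)"
proof -
  have "convex_on UNIV (\<lambda>x. - f x)" using assms by (simp add: concave_on_def)
  from convex_le_Inf_differential[OF this, of x]
  have "f y \<le> f x + - Inf ((\<lambda>t. (- f x - - f t) / (x - t)) ` ({x<..} \<inter> UNIV)) * (y - x)" for y
    by (simp add: algebra_simps)
  then show ?thesis by (rule that)
qed

text \<open>The infimum of the tangents at the points of \<open>[-R, R]\<close>; the bound by the tangent at \<open>0\<close> is
  uniform in \<open>R\<close>.\<close>

lemma concave_lipschitz_majorant:
  fixes f :: "real \<Rightarrow> real"
  assumes conc: "concave_on UNIV f"
  obtains s where "\<And>R. R > 0 \<Longrightarrow> \<exists>g L. concave_on UNIV g \<and> (\<forall>x y. \<bar>g x - g y\<bar> \<le> L * \<bar>x - y\<bar>) \<and>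
      (\<forall>y. \<bar>y\<bar> \<le> R \<longrightarrow> g y = f y) \<and> (\<forall>y. f y \<le> g y) \<and> (\<forall>y. g y \<le> f 0 + s * y)"
proof -
  have "\<exists>s. \<forall>x y. f y \<le> f x + s x * (y - x)"
  proof (intro choice allI)
    show "\<exists>c. \<forall>y. f y \<le> f x + c * (y - x)" for x
      using concave_supergradient[OF conc, of x] by blast
  qed
  then obtain s where s: "\<And>x y. f y \<le> f x + s x * (y - x)" by blast
  have cont: "continuous_on UNIV f"
    using convex_on_continuous[of UNIV "\<lambda>x. - f x"] conc continuous_on_minus
    by (fastforce simp: concave_on_def)
  show thesis
  proof (rule that[of "s 0"])
    fix R :: real assume "R > 0"
    \<comment> \<open>One unit of room beyond \<open>R\<close>: comparing the tangent at
      \<open>z\<close> with the values at \<open>z - 1\<close> and \<open>z + 1\<close> bounds the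
      slope \<open>s z\<close> by \<open>2 * b\<close>, which becomes the Lipschitz constant of the
      infimum.\<close>
    have "bounded (f ` {-R-1..R+1})"
      by (intro compact_imp_bounded compact_continuous_image continuous_on_subset[OF cont]) auto
    then obtain b where "\<forall>x\<in>{-R-1..R+1}. \<bar>f x\<bar> \<le> b"
      by (auto simp: bounded_iff)
    then have b: "\<bar>f x\<bar> \<le> b" if "\<bar>x\<bar> \<le> R + 1" for x
      using that by (auto simp: abs_le_iff)
    have s_bd: "\<bar>s z\<bar> \<le> 2 * b" if "\<bar>z\<bar> \<le> R" for z
      using s[of "z + 1" z] s[of "z - 1" z] b[of z] b[of "z + 1"] b[of "z - 1"] that
      by (auto simp: abs_le_iff)
    define g where "g y = (INF z\<in>{-R..R}. f z + s z * (y - z))" for y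
    have bdd: "bdd_below ((\<lambda>z. f z + s z * (y - z)) ` {-R..R})" for y
      using s by (auto intro!: bdd_belowI[of _ "f y"])
    have lower: "g y \<le> f z + s z * (y - z)" if "\<bar>z\<bar> \<le> R" for y z
      unfolding g_def using that by (intro cINF_lower bdd) auto
    have greatest: "c \<le> g y" if "\<And>z. \<bar>z\<bar> \<le> R \<Longrightarrow> c \<le> f z + s z * (y - z)" for c y
      unfolding g_def using \<open>R > 0\<close> by (intro cINF_greatest) (auto intro!: that)
    have fg: "f y \<le> g y" for y by (intro greatest s)
    have "concave_on UNIV g"
      unfolding concave_on_iff
    proof (intro conjI ballI allI impI greatest)
      fix x y u v z :: real
      assume uv: "0 \<le> u" "0 \<le> v" "u + v = 1" and "\<bar>z\<bar> \<le> R"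
      then have "u * g x + v * g y \<le> u * (f z + s z * (x - z)) + v * (f z + s z * (y - z))"
        by (intro add_mono mult_left_mono lower) auto
      also have "\<dots> = (u + v) * f z + s z * (u * x + v * y - (u + v) * z)" by (simp add: algebra_simps)
      finally show "u * g x + v * g y \<le> f z + s z * (u *\<^sub>R x + v *\<^sub>R y - z)"
        using uv by simp
    qed simp
    moreover have "\<bar>g x - g y\<bar> \<le> 2 * b * \<bar>x - y\<bar>" for x y
    proof -
      have *: "g x - 2 * b * \<bar>x - y\<bar> \<le> g y" for x y
      proof (rule greatest)
        fix z assume z: "\<bar>z\<bar> \<le> R"
        have "s z * (x - y) \<le> \<bar>s z\<bar> * \<bar>x - y\<bar>" by (metis abs_ge_self abs_mult)
        also have "\<dots> \<le> 2 * b * \<bar>x - y\<bar>" using s_bd[OF z] by (intro mult_right_mono) auto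
        finally show "g x - 2 * b * \<bar>x - y\<bar> \<le> f z + s z * (y - z)"
          using lower[OF z, of x] by (simp add: algebra_simps)
      qed
      show ?thesis using *[of x y] *[of y x] by (simp add: abs_le_iff abs_minus_commute)
    qed
    moreover have "g y = f y" if "\<bar>y\<bar> \<le> R" for y
      using lower[OF that, of y] fg[of y] by simp
    moreover have "g y \<le> f 0 + s 0 * y" for y
      using lower[of 0 y] \<open>R > 0\<close> by simp
    ultimately show "\<exists>g L. concave_on UNIV g \<and> (\<forall>x y. \<bar>g x - g y\<bar> \<le> L * \<bar>x - y\<bar>) \<and>
        (\<forall>y. \<bar>y\<bar> \<le> R \<longrightarrow> g y = f y) \<and> (\<forall>y. f y \<le> g y) \<and> (\<forall>y. g y \<le> f 0 + s 0 * y)"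
      using fg by (intro exI[of _ g] exI[of _ "2 * b"]) auto
  qed
qed

subsection \<open>Independence and predictable strategies\<close>

declare One_nat_def [simp del]

locale bandit = prob_space M
  for M :: "'a measure" +
  fixes K :: nat and X :: "nat \<Rightarrow> 'a \<Rightarrow> real" and Y :: "nat \<Rightarrow> nat \<Rightarrow> 'a \<Rightarrow> real"
  assumes integrable_payoff: "\<And>k. k \<in> {1..K} \<Longrightarrow> integrable M (X k)"
    and integrable_payoff_square: "\<And>k. k \<in> {1..K} \<Longrightarrow> integrable M (\<lambda>\<omega>. (X k \<omega>)\<^sup>2)"
    and distr_copy: "\<And>k n. k \<in> {1..K} \<Longrightarrow> n \<ge> 1 \<Longrightarrow> distr M borel (Y k n) = distr M borel (X k)"
    and indep_copies: "indep_vars (\<lambda>_. borel) (\<lambda>(k, n). Y k n) ({1..K} \<times> {1..})"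
begin

abbreviation mean :: "nat \<Rightarrow> real" where "mean \<equiv> arm_mean M X"
abbreviation var :: "nat \<Rightarrow> real" where "var \<equiv> arm_var M X"

lemma measurable_payoff: "k \<in> {1..K} \<Longrightarrow> X k \<in> borel_measurable M"
  using integrable_payoff by auto

lemma measurable_copy: "k \<in> {1..K} \<Longrightarrow> n \<ge> 1 \<Longrightarrow> Y k n \<in> borel_measurable M"
  using indep_copies unfolding indep_vars_def2 by auto

lemma integral_copy:
  assumes "k \<in> {1..K}" "n \<ge> 1" "f \<in> borel_measurable borel"
  shows "(\<integral>\<omega>. f (Y k n \<omega>) \<partial>M) = (\<integral>\<omega>. f (X k \<omega>) \<partial>M :: real)"
proof -
  have "(\<integral>\<omega>. f (Y k n \<omega>) \<partial>M) = (\<integral>x. f x \<partial>distr M borel (Y k n))"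
    using assms measurable_copy by (subst integral_distr) auto
  also have "\<dots> = (\<integral>\<omega>. f (X k \<omega>) \<partial>M)"
    using assms measurable_payoff distr_copy by (subst integral_distr[symmetric]) auto
  finally show ?thesis .
qed

lemma integrable_copy:
  fixes f :: "real \<Rightarrow> real"
  assumes "k \<in> {1..K}" "n \<ge> 1" "f \<in> borel_measurable borel" "integrable M (\<lambda>\<omega>. f (X k \<omega>))"
  shows "integrable M (\<lambda>\<omega>. f (Y k n \<omega>))"
proof -
  have "integrable (distr M borel (X k)) f"
    using assms measurable_payoff by (simp add: integrable_distr_eq)
  then show ?thesis
    using assms measurable_copy distr_copy by (metis integrable_distr)
qed

text \<open>All copies of the stages in \<open>J\<close> generate it, those of arms not chosen
  included. Unlike the history it does not depend on the strategy, so independence of disjoint sets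
  of stages applies to it directly.\<close>

definition stage_algebra :: "nat set \<Rightarrow> 'a measure" where
  "stage_algebra J = vimage_algebra (space M) (\<lambda>\<omega>. \<lambda>p\<in>{1..K} \<times> J. (case p of (k, n) \<Rightarrow> Y k n) \<omega>)
     (PiM ({1..K} \<times> J) (\<lambda>_. borel))"

lemma space_stage_algebra [simp]: "space (stage_algebra J) = space M"
  by (simp add: stage_algebra_def)

lemma measurable_stage_algebra_copy:
  assumes "k \<in> {1..K}" "n \<in> J"
  shows "Y k n \<in> borel_measurable (stage_algebra J)"
proof -
  have "(\<lambda>\<omega>. \<lambda>p\<in>{1..K} \<times> J. (case p of (k, n) \<Rightarrow> Y k n) \<omega>)
      \<in> stage_algebra J \<rightarrow>\<^sub>M PiM ({1..K} \<times> J) (\<lambda>_. borel)"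
    unfolding stage_algebra_def by (rule measurable_vimage_algebra1) (auto simp: space_PiM)
  from measurable_compose[OF this measurable_component_singleton[of "(k, n)"]]
  show ?thesis using assms by simp
qed

text \<open>Minimality of the generated \<sigma>-algebra, phrased through the identity map so that
  composition transfers measurability to any finer \<sigma>-algebra on the same space.\<close>

lemma measurable_id_stage_algebra:
  assumes "space N = space M" "\<And>k n. k \<in> {1..K} \<Longrightarrow> n \<in> J \<Longrightarrow> Y k n \<in> borel_measurable N"
  shows "(\<lambda>\<omega>. \<omega>) \<in> N \<rightarrow>\<^sub>M stage_algebra J"
  unfolding stage_algebra_def
proof (rule measurable_vimage_algebra2)
  show "(\<lambda>\<omega>. \<lambda>p\<in>{1..K} \<times> J. (case p of (k, n) \<Rightarrow> Y k n) \<omega>) \<in> N \<rightarrow>\<^sub>M PiM ({1..K} \<times> J) (\<lambda>_. borel)"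
    using assms(2) by (intro measurable_restrict) auto
qed (use assms(1) in auto)

lemma measurable_stage_algebra_mono:
  assumes "f \<in> stage_algebra J \<rightarrow>\<^sub>M N" "J \<subseteq> J'"
  shows "f \<in> stage_algebra J' \<rightarrow>\<^sub>M N"
  using measurable_compose[OF measurable_id_stage_algebra assms(1), of "stage_algebra J'"] assms(2)
    measurable_stage_algebra_copy by auto

lemma measurable_stage_algebra_imp:
  assumes "f \<in> stage_algebra J \<rightarrow>\<^sub>M N" "J \<subseteq> {1..}"
  shows "f \<in> M \<rightarrow>\<^sub>M N"
  using measurable_compose[OF measurable_id_stage_algebra assms(1), of M] assms(2) measurable_copy by auto

text \<open>The index sets \<open>{1..K} \<times> J\<close> and \<open>{(k, i)}\<close> are
  disjoint, so the corresponding blocks of copies are independent. The generated \<sigma>-algebras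
  are compared directly, which avoids writing \<open>f\<close> as a function of the copies.\<close>

lemma indep_var_stage_algebra:
  fixes f :: "'a \<Rightarrow> real" and h :: "real \<Rightarrow> real"
  assumes f: "f \<in> borel_measurable (stage_algebra J)" and h: "h \<in> borel_measurable borel"
    and J: "J \<subseteq> {1..}" "i \<ge> 1" "i \<notin> J" and k: "k \<in> {1..K}"
  shows "indep_var borel f borel (\<lambda>\<omega>. h (Y k i \<omega>))"
proof -
  define RA where "RA = (\<lambda>\<omega>. \<lambda>p\<in>{1..K} \<times> J. (case p of (k, n) \<Rightarrow> Y k n) \<omega>)"
  define RB where "RB = (\<lambda>\<omega>. \<lambda>p\<in>{(k, i)}. (case p of (k, n) \<Rightarrow> Y k n) \<omega>)"
  have 1: "indep_var (PiM ({1..K} \<times> J) (\<lambda>_. borel)) RA (PiM {(k, i)} (\<lambda>_. borel)) RB"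
    unfolding RA_def RB_def by (rule indep_var_restrict[OF indep_copies]) (use J k in auto)
  then have ind: "indep_set (sigma_sets (space M) {RA -` A \<inter> space M |A. A \<in> sets (PiM ({1..K} \<times> J) (\<lambda>_. borel))})
      (sigma_sets (space M) {RB -` A \<inter> space M |A. A \<in> sets (PiM {(k, i)} (\<lambda>_. borel))})"
    by (simp add: indep_var_eq)
  have "{(\<lambda>\<omega>. h (Y k i \<omega>)) -` A \<inter> space M |A. A \<in> sets borel}
      \<subseteq> {RB -` A \<inter> space M |A. A \<in> sets (PiM {(k, i)} (\<lambda>_. borel))}"
  proof clarify
    fix A :: "real set" assume A: "A \<in> sets borel"
    have m: "(\<lambda>x. h (x (k, i))) \<in> PiM {(k, i)} (\<lambda>_. borel) \<rightarrow>\<^sub>M borel" using h by measurable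
    show "\<exists>B. (\<lambda>\<omega>. h (Y k i \<omega>)) -` A \<inter> space M = RB -` B \<inter> space M \<and> B \<in> sets (PiM {(k, i)} (\<lambda>_. borel))"
      by (rule exI[of _ "(\<lambda>x. h (x (k, i))) -` A \<inter> space (PiM {(k, i)} (\<lambda>_. borel))"])
        (use measurable_sets[OF m A] in \<open>auto simp: RB_def space_PiM\<close>)
  qed
  then have RB: "sigma_sets (space M) {(\<lambda>\<omega>. h (Y k i \<omega>)) -` A \<inter> space M |A. A \<in> sets borel}
      \<subseteq> sigma_sets (space M) {RB -` A \<inter> space M |A. A \<in> sets (PiM {(k, i)} (\<lambda>_. borel))}"
    by (rule sigma_sets_mono')
  have "sigma_sets (space M) {f -` A \<inter> space M |A. A \<in> sets borel} \<subseteq> sets (stage_algebra J)"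
    using measurable_sets[OF f] by (intro sets.sigma_sets_subset'[of _ "stage_algebra J", simplified]) 
      (auto intro: sets.top[of "stage_algebra J", simplified])
  also have "sets (stage_algebra J)
      = sigma_sets (space M) {RA -` A \<inter> space M |A. A \<in> sets (PiM ({1..K} \<times> J) (\<lambda>_. borel))}"
    by (simp add: stage_algebra_def sets_vimage_algebra RA_def)
  finally have "indep_set (sigma_sets (space M) {f -` A \<inter> space M |A. A \<in> sets borel})
      (sigma_sets (space M) {(\<lambda>\<omega>. h (Y k i \<omega>)) -` A \<inter> space M |A. A \<in> sets borel})"
    using ind RB unfolding indep_set_def by (elim indep_sets_mono_sets) (auto split: bool.split)
  then show ?thesis
    using measurable_stage_algebra_imp[OF f J(1)] measurable_compose[OF measurable_copy[OF k J(2)] h] by (auto simp: indep_var_eq)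
qed

text \<open>Since the choice at stage \<open>i\<close> takes finitely many values, independence of each single copy
  \<open>Y k i\<close> from the other stages suffices.\<close>

lemma chosen_copy:
  fixes b :: "'a \<Rightarrow> real" and h :: "nat \<Rightarrow> real \<Rightarrow> real"
  assumes b: "b \<in> borel_measurable (stage_algebra J)" "integrable M b"
    and t: "t \<in> stage_algebra J \<rightarrow>\<^sub>M count_space {1..K}"
    and h: "\<And>k. k \<in> {1..K} \<Longrightarrow> h k \<in> borel_measurable borel"
      "\<And>k. k \<in> {1..K} \<Longrightarrow> integrable M (\<lambda>\<omega>. h k (X k \<omega>))"
    and J: "J \<subseteq> {1..}" "i \<ge> 1" "i \<notin> J"
  shows integrable_chosen_copy: "integrable M (\<lambda>\<omega>. b \<omega> * h (t \<omega>) (Y (t \<omega>) i \<omega>))"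
    and integral_chosen_copy: "(\<integral>\<omega>. b \<omega> * h (t \<omega>) (Y (t \<omega>) i \<omega>) \<partial>M)
      = (\<integral>\<omega>. b \<omega> * (\<integral>\<omega>'. h (t \<omega>) (X (t \<omega>) \<omega>') \<partial>M) \<partial>M)"
proof -
  have tM: "t \<in> M \<rightarrow>\<^sub>M count_space {1..K}"
    by (rule measurable_stage_algebra_imp[OF t J(1)])
  have [measurable]: "Measurable.pred (stage_algebra J) (\<lambda>\<omega>. t \<omega> = k)" for k
    using t by measurable
  have [measurable]: "Measurable.pred M (\<lambda>\<omega>. t \<omega> = k)" for k
    using tM by measurable
  \<comment> \<open>Splits according to the value of the choice: on the event
    \<open>t \<omega> = k\<close> the random index is constant, and the weight \<open>c k\<close>
    still depends on stages in \<open>J\<close> only, hence is independent of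
    \<open>Y k i\<close>.\<close>
  define c where "c k \<omega> = b \<omega> * of_bool (t \<omega> = k)" for k \<omega>
  have c: "c k \<in> borel_measurable (stage_algebra J)" for k
    using b(1) unfolding c_def by measurable
  have ci: "integrable M (c k)" for k
    unfolding c_def using b(2)
    by (rule Bochner_Integration.integrable_bound) (use b(2) in \<open>auto intro!: measurable_stage_algebra_imp[OF c[unfolded c_def] J(1)]\<close>)
  have ind: "indep_var borel (c k) borel (\<lambda>\<omega>. h k (Y k i \<omega>))" if "k \<in> {1..K}" for k
    using that c h J by (intro indep_var_stage_algebra) auto
  have hi: "integrable M (\<lambda>\<omega>. h k (Y k i \<omega>))" if "k \<in> {1..K}" for k
    using that h J by (intro integrable_copy) auto
  have int: "integrable M (\<lambda>\<omega>. c k \<omega> * h k (Y k i \<omega>))" if "k \<in> {1..K}" for k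
    using that by (intro indep_var_integrable ci hi ind)
  have sum: "(\<Sum>k\<in>{1..K}. c k \<omega> * f k) = b \<omega> * f (t \<omega>)" if "\<omega> \<in> space M" for \<omega> f
  proof -
    have "(\<Sum>k\<in>{1..K}. c k \<omega> * f k) = (\<Sum>k\<in>{1..K}. if k = t \<omega> then b \<omega> * f k else 0)"
      by (intro sum.cong) (auto simp: c_def)
    then show ?thesis using measurable_space[OF tM that] by simp
  qed
  have "integrable M (\<lambda>\<omega>. \<Sum>k\<in>{1..K}. c k \<omega> * h k (Y k i \<omega>))"
    by (intro Bochner_Integration.integrable_sum int)
  then show "integrable M (\<lambda>\<omega>. b \<omega> * h (t \<omega>) (Y (t \<omega>) i \<omega>))"
    by (rule Bochner_Integration.integrable_cong[THEN iffD1, OF refl, rotated]) (simp add: sum)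
  have "(\<integral>\<omega>. b \<omega> * h (t \<omega>) (Y (t \<omega>) i \<omega>) \<partial>M) = (\<integral>\<omega>. (\<Sum>k\<in>{1..K}. c k \<omega> * h k (Y k i \<omega>)) \<partial>M)"
    by (intro Bochner_Integration.integral_cong) (simp_all add: sum)
  also have "\<dots> = (\<Sum>k\<in>{1..K}. \<integral>\<omega>. c k \<omega> * h k (Y k i \<omega>) \<partial>M)"
    by (intro Bochner_Integration.integral_sum int)
  also have "\<dots> = (\<Sum>k\<in>{1..K}. (\<integral>\<omega>. c k \<omega> * (\<integral>\<omega>'. h k (X k \<omega>') \<partial>M) \<partial>M))"
    using h J by (intro sum.cong refl) (simp add: indep_var_lebesgue_integral[OF ind ci hi] integral_copy)
  also have "\<dots> = (\<integral>\<omega>. (\<Sum>k\<in>{1..K}. c k \<omega> * (\<integral>\<omega>'. h k (X k \<omega>') \<partial>M)) \<partial>M)"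
    using ci by (intro Bochner_Integration.integral_sum[symmetric]) auto
  also have "\<dots> = (\<integral>\<omega>. b \<omega> * (\<integral>\<omega>'. h (t \<omega>) (X (t \<omega>) \<omega>') \<partial>M) \<partial>M)"
    by (intro Bochner_Integration.integral_cong) (simp_all add: sum)
  finally show "(\<integral>\<omega>. b \<omega> * h (t \<omega>) (Y (t \<omega>) i \<omega>) \<partial>M) = \<dots>" .
qed

text \<open>Weaker than admissibility: the choice may use every copy of the strictly earlier stages,
  also of arms that were not played. The estimates on sums are uniform over this class, whose
  information does not depend on the strategy.\<close>

definition predictable :: "(nat \<Rightarrow> 'a \<Rightarrow> nat) \<Rightarrow> bool" where
  "predictable t \<longleftrightarrow> (\<forall>n\<ge>1. t n \<in> stage_algebra {1..<n} \<rightarrow>\<^sub>M count_space {1..K})"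

lemma predictable_const: "k \<in> {1..K} \<Longrightarrow> predictable (\<lambda>n \<omega>. k)"
  by (simp add: predictable_def)

lemma predictableD:
  assumes "predictable t" "n \<ge> 1" "{1..<n} \<subseteq> J"
  shows "t n \<in> stage_algebra J \<rightarrow>\<^sub>M count_space {1..K}"
  using assms measurable_stage_algebra_mono unfolding predictable_def by blast

lemma predictable_arm:
  assumes "predictable t" "n \<ge> 1" "\<omega> \<in> space M"
  shows "t n \<omega> \<in> {1..K}"
  using measurable_space[OF predictableD[OF assms(1,2) order_refl], of \<omega>] assms(3) by simp

lemma measurable_chosen_copy:
  assumes "t \<in> stage_algebra J \<rightarrow>\<^sub>M count_space {1..K}" "n \<in> J"
    "\<And>k. k \<in> {1..K} \<Longrightarrow> h k \<in> borel_measurable borel"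
  shows "(\<lambda>\<omega>. h (t \<omega>) (Y (t \<omega>) n \<omega>)) \<in> borel_measurable (stage_algebra J)"
  by (rule measurable_compose_countable'[OF _ assms(1)])
    (auto intro!: measurable_compose[OF measurable_stage_algebra_copy assms(3)] assms(2))

section \<open>From admissible to predictable strategies\<close>

lemma history_subset:
  assumes "\<And>i. i \<in> {1..m} \<Longrightarrow> \<theta> i \<in> stage_algebra {1..m} \<rightarrow>\<^sub>M count_space {1..K}"
  shows "sets (history M Y \<theta> m) \<subseteq> sets (stage_algebra {1..m})"
proof -
  have r: "reward Y \<theta> i \<in> borel_measurable (stage_algebra {1..m})" if "i \<in> {1..m}" for i
    using measurable_chosen_copy[OF assms[OF that] that, of "\<lambda>k x. x"] by (simp add: reward_def[abs_def])
  have \<theta>: "\<theta> i -` B \<inter> space M \<in> sets (stage_algebra {1..m})" if "i \<in> {1..m}" for i B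
  proof -
    \<comment> \<open>The history is generated by preimages of arbitrary sets of numbers, whereas
      measurability of the choice concerns subsets of \<open>{1..K}\<close>; intersecting with the
      range reconciles the two.\<close>
    have "\<theta> i -` B \<inter> space M = \<theta> i -` (B \<inter> {1..K}) \<inter> space (stage_algebra {1..m})"
      using measurable_space[OF assms[OF that]] by auto
    then show ?thesis
      using measurable_sets[OF assms[OF that], of "B \<inter> {1..K}"] by (simp del: vimage_Int)
  qed
  show ?thesis
    unfolding history_def
  proof (subst sets_measure_of)
    show "sigma_sets (space M) ((\<Union>i\<in>{1..m}. {reward Y \<theta> i -` B \<inter> space M |B. B \<in> sets borel}) \<union>
        (\<Union>i\<in>{1..m}. {\<theta> i -` B \<inter> space M |B. B \<in> sets (count_space UNIV)}))
        \<subseteq> sets (stage_algebra {1..m})"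
      using r[THEN measurable_sets] \<theta> sets.top[of "stage_algebra {1..m}"]
      by (intro sets.sigma_sets_subset') auto
  qed auto
qed

text \<open>The history is itself built from the strategy, hence the strong induction: once the
  earlier choices are functions of earlier copies, so are the earlier rewards, and with them
  everything the next choice may use.\<close>

lemma admissible_predictable:
  assumes "\<theta> \<in> admissible_strategies M K Y"
  shows "predictable \<theta>"
  unfolding predictable_def
proof (intro allI impI)
  fix n :: nat assume "n \<ge> 1"
  then show "\<theta> n \<in> stage_algebra {1..<n} \<rightarrow>\<^sub>M count_space {1..K}"
  proof (induction n rule: less_induct)
    case (less n)
    have eq: "{1..<n} = {1..n - 1}" using less.prems by auto
    have "\<theta> i \<in> stage_algebra {1..n - 1} \<rightarrow>\<^sub>M count_space {1..K}" if "i \<in> {1..n - 1}" for i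
      using that by (intro measurable_stage_algebra_mono[OF less.IH]) auto
    then have "sets (history M Y \<theta> (n - 1)) \<subseteq> sets (stage_algebra {1..<n})"
      unfolding eq by (rule history_subset)
    moreover have "\<theta> n \<in> history M Y \<theta> (n - 1) \<rightarrow>\<^sub>M count_space {1..K}"
      using assms less.prems by (simp add: admissible_strategies_def)
    moreover have "space (history M Y \<theta> (n - 1)) = space M"
      unfolding history_def by (rule space_measure_of) auto
    ultimately show ?case
      by (auto simp: measurable_def)
  qed
qed

lemma const_admissible: "k \<in> {1..K} \<Longrightarrow> (\<lambda>n \<omega>. k) \<in> admissible_strategies M K Y"
  by (simp add: admissible_strategies_def)

text \<open>Tested against the indicator of an event of the past, the reward may be replaced by the
  mean of the chosen arm, since the copies of stage \<open>n\<close> are independent of all earlier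
  stages. This turns the abstract conditional expectation in the utility into an explicit function
  of the choice.\<close>

lemma cond_exp_reward:
  assumes adm: "\<theta> \<in> admissible_strategies M K Y" and "n \<ge> 1"
  shows "AE \<omega> in M. real_cond_exp M (history M Y \<theta> (n - 1)) (reward Y \<theta> n) \<omega> = mean (\<theta> n \<omega>)"
proof -
  let ?H = "history M Y \<theta> (n - 1)" and ?J = "{1..<n}"
  have t: "\<theta> n \<in> stage_algebra ?J \<rightarrow>\<^sub>M count_space {1..K}"
    using admissible_predictable[OF adm] \<open>n \<ge> 1\<close> by (intro predictableD) auto
  have eq: "?J = {1..n - 1}" using \<open>n \<ge> 1\<close> by auto
  have sub: "sets ?H \<subseteq> sets (stage_algebra ?J)"
    unfolding eq by (intro history_subset predictableD[OF admissible_predictable[OF adm]]) auto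
  have subM: "sets (stage_algebra ?J) \<subseteq> sets M"
  proof
    fix A assume A: "A \<in> sets (stage_algebra ?J)"
    have "(\<lambda>\<omega>. \<omega>) \<in> M \<rightarrow>\<^sub>M stage_algebra ?J"
      using measurable_copy by (intro measurable_id_stage_algebra) auto
    from measurable_sets[OF this A] show "A \<in> sets M"
      using sets.sets_into_space[OF A] by (simp add: Int_absorb2)
  qed
  have spH: "space ?H = space M"
    unfolding history_def by (rule space_measure_of) auto
  interpret H: finite_measure_subalgebra M ?H
    using sub subM spH by unfold_locales (auto simp: subalgebra_def)
  have int_h: "integrable M (\<lambda>\<omega>. indicator A \<omega> * reward Y \<theta> n \<omega>)"
      "(\<integral>\<omega>. indicator A \<omega> * reward Y \<theta> n \<omega> \<partial>M) = (\<integral>\<omega>. indicator A \<omega> * mean (\<theta> n \<omega>) \<partial>M)"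
    if "A \<in> sets (stage_algebra ?J)" for A
  proof -
    have A: "integrable M (indicator A :: 'a \<Rightarrow> real)" using that subM by (auto intro!: integrable_real_indicator simp: less_top[symmetric])
    show "integrable M (\<lambda>\<omega>. indicator A \<omega> * reward Y \<theta> n \<omega>)"
      unfolding reward_def
      by (rule integrable_chosen_copy[OF _ A t]) (use that integrable_payoff \<open>n \<ge> 1\<close> in auto)
    show "(\<integral>\<omega>. indicator A \<omega> * reward Y \<theta> n \<omega> \<partial>M) = (\<integral>\<omega>. indicator A \<omega> * mean (\<theta> n \<omega>) \<partial>M)"
      unfolding reward_def arm_mean_def
      by (rule integral_chosen_copy[OF _ A t]) (use that integrable_payoff \<open>n \<ge> 1\<close> in auto)
  qed
  show ?thesis
  proof (rule H.real_cond_exp_charact)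
    fix A assume "A \<in> sets ?H"
    then show "(LINT x:A|M. reward Y \<theta> n x) = (LINT x:A|M. mean (\<theta> n x))"
      using int_h(2) sub by (auto simp: set_lebesgue_integral_def)
  next
    show "integrable M (reward Y \<theta> n)"
      using int_h(1)[OF sets.top] by (rule Bochner_Integration.integrable_cong[THEN iffD1, OF refl, rotated]) simp
    \<comment> \<open>Here admissibility itself enters, not just predictability: the candidate must
      be measurable for the history and not only for the larger \<sigma>-algebra of the earlier
      stages.\<close>
    have tH: "\<theta> n \<in> ?H \<rightarrow>\<^sub>M count_space {1..K}"
      using adm \<open>n \<ge> 1\<close> by (simp add: admissible_strategies_def)
    show mH: "(\<lambda>\<omega>. mean (\<theta> n \<omega>)) \<in> borel_measurable ?H"
      using measurable_compose[OF tH, of mean borel] by simp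
    have "(\<lambda>\<omega>. mean (\<theta> n \<omega>)) \<in> borel_measurable M"
      using measurable_from_subalg[OF H.subalg mH] .
    moreover have "AE \<omega> in M. norm (mean (\<theta> n \<omega>)) \<le> Max ((\<lambda>k. norm (mean k)) ` {1..K})"
      using measurable_space[OF t] by (intro AE_I2 Max_ge) auto
    ultimately show "integrable M (\<lambda>\<omega>. mean (\<theta> n \<omega>))"
      by (intro integrable_const_bound) auto
  qed
qed

end

subsection \<open>Moment bounds\<close>

context bandit
begin

text \<open>A pointwise version of the martingale increment: for admissible strategies it equals the
  reward minus its conditional expectation almost everywhere. It also makes sense for strategies
  that are merely predictable, and its value depends on the choice at stage \<open>j\<close>
  alone.\<close>

definition innovation :: "(nat \<Rightarrow> 'a \<Rightarrow> nat) \<Rightarrow> nat \<Rightarrow> 'a \<Rightarrow> real" where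
  "innovation t j \<omega> = Y (t j \<omega>) j \<omega> - mean (t j \<omega>)"

definition centred_sum :: "(nat \<Rightarrow> 'a \<Rightarrow> nat) \<Rightarrow> nat \<Rightarrow> 'a \<Rightarrow> real" where
  "centred_sum t n \<omega> = (\<Sum>j=1..n. innovation t j \<omega>)"

lemma measurable_innovation:
  assumes "t j \<in> stage_algebra J \<rightarrow>\<^sub>M count_space {1..K}" "j \<in> J"
  shows "innovation t j \<in> borel_measurable (stage_algebra J)"
  using measurable_chosen_copy[OF assms, of "\<lambda>k x. x - mean k"] by (simp add: innovation_def[abs_def])

lemma measurable_centred_sum:
  assumes "predictable t" "n < m"
  shows "centred_sum t n \<in> borel_measurable (stage_algebra {1..<m})"
  unfolding centred_sum_def[abs_def] using assms
  by (intro borel_measurable_sum measurable_innovation predictableD) auto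

lemma measurable_centred_sum_M:
  assumes "predictable t"
  shows "centred_sum t n \<in> borel_measurable M"
  by (rule measurable_stage_algebra_imp[OF measurable_centred_sum[OF assms lessI]]) auto

lemma integrable_centred_square:
  assumes "k \<in> {1..K}"
  shows "integrable M (\<lambda>\<omega>. (X k \<omega> - mean k)\<^sup>2)"
proof -
  have "integrable M (\<lambda>\<omega>. (X k \<omega>)\<^sup>2 - 2 * X k \<omega> * mean k + (mean k)\<^sup>2)"
    using integrable_payoff integrable_payoff_square assms by auto
  then show ?thesis by (simp add: power2_diff algebra_simps)
qed

lemma expectation_centred: "k \<in> {1..K} \<Longrightarrow> (\<integral>\<omega>. X k \<omega> - mean k \<partial>M) = 0"
  using integrable_payoff by (simp add: arm_mean_def prob_space)

text \<open>The first-order term has mean 0 because its coefficient depends on earlier stages only.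
  In the remainder, \<open>c \<le> 1\<close> allows the factor \<open>c\<^sup>2\<close> to be pulled
  out while the rest is bounded by the power \<open>q\<close> of \<open>1 + d\<^sup>2\<close>, whose
  expectation is at most \<open>m\<close> for every arm.\<close>

lemma centred_sum_moment_step:
  assumes g: "C \<ge> 0" "continuous_on UNIV g" "\<And>x. \<bar>g x\<bar> \<le> C * (1 + x\<^sup>2) powr q"
      "\<And>x d. (1 + (x + d)\<^sup>2) powr q
         \<le> (1 + x\<^sup>2) powr q + g x * d + C * (1 + x\<^sup>2) powr q * ((1 + d\<^sup>2) powr (q - 1) * d\<^sup>2)"
    and q: "q \<ge> 1"
    and X: "\<And>k. k \<in> {1..K} \<Longrightarrow> integrable M (\<lambda>\<omega>. (1 + (X k \<omega> - mean k)\<^sup>2) powr q)"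
      "\<And>k. k \<in> {1..K} \<Longrightarrow> (\<integral>\<omega>. (1 + (X k \<omega> - mean k)\<^sup>2) powr q \<partial>M) \<le> m"
    and t: "predictable t" and c: "0 \<le> c" "c \<le> 1"
    and int: "integrable M (\<lambda>\<omega>. (1 + (c * centred_sum t n \<omega>)\<^sup>2) powr q)"
  shows "integrable M (\<lambda>\<omega>. (1 + (c * centred_sum t (Suc n) \<omega>)\<^sup>2) powr q)"
    and "(\<integral>\<omega>. (1 + (c * centred_sum t (Suc n) \<omega>)\<^sup>2) powr q \<partial>M)
      \<le> (1 + C * m * c\<^sup>2) * (\<integral>\<omega>. (1 + (c * centred_sum t n \<omega>)\<^sup>2) powr q \<partial>M)"
proof -
  let ?J = "{1..<Suc n}"
  define x where "x \<omega> = c * centred_sum t n \<omega>" for \<omega>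
  define G where "G w = (1 + w\<^sup>2) powr q" for w :: real
  define D where "D \<omega> = innovation t (Suc n) \<omega>" for \<omega>
  have ts: "t (Suc n) \<in> stage_algebra ?J \<rightarrow>\<^sub>M count_space {1..K}"
    using t by (intro predictableD) auto
  have gb [measurable]: "g \<in> borel_measurable borel"
    using g(2) by (intro borel_measurable_continuous_onI)
  have Gb [measurable]: "G \<in> borel_measurable borel" unfolding G_def[abs_def] by measurable
  have xs [measurable]: "x \<in> borel_measurable (stage_algebra ?J)"
    unfolding x_def[abs_def] using measurable_centred_sum[OF t, of n "Suc n"] by auto
  have [measurable]: "x \<in> borel_measurable M"
    by (rule measurable_stage_algebra_imp[OF xs]) auto
  have Gx: "integrable M (\<lambda>\<omega>. G (x \<omega>))" using int by (simp add: G_def x_def)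
  have gx: "integrable M (\<lambda>\<omega>. g (x \<omega>))"
  proof (rule Bochner_Integration.integrable_bound)
    show "integrable M (\<lambda>\<omega>. C * G (x \<omega>))" using Gx by simp
    show "AE \<omega> in M. norm (g (x \<omega>)) \<le> norm (C * G (x \<omega>))"
      using g(1,3) by (intro AE_I2) (auto simp: G_def abs_mult)
  qed simp
  have J: "?J \<subseteq> {1..}" "Suc n \<ge> 1" "Suc n \<notin> ?J" by auto
  have 1: "integrable M (\<lambda>\<omega>. g (x \<omega>) * D \<omega>)" "(\<integral>\<omega>. g (x \<omega>) * D \<omega> \<partial>M) = 0"
  proof -
    have s: "(\<lambda>\<omega>. g (x \<omega>)) \<in> borel_measurable (stage_algebra ?J)" by simp
    show "integrable M (\<lambda>\<omega>. g (x \<omega>) * D \<omega>)"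
      unfolding D_def innovation_def
      by (rule integrable_chosen_copy[OF s gx ts _ _ J, of "\<lambda>k x. x - mean k"]) (use integrable_payoff in auto)
    have "(\<integral>\<omega>. g (x \<omega>) * D \<omega> \<partial>M) = (\<integral>\<omega>. g (x \<omega>) * (\<integral>\<omega>'. X (t (Suc n) \<omega>) \<omega>' - mean (t (Suc n) \<omega>) \<partial>M) \<partial>M)"
      unfolding D_def innovation_def
      by (rule integral_chosen_copy[OF s gx ts _ _ J, of "\<lambda>k x. x - mean k"]) (use integrable_payoff in auto)
    also have "\<dots> = (\<integral>\<omega>. g (x \<omega>) * 0 \<partial>M)"
      using t by (intro Bochner_Integration.integral_cong refl) (simp only: expectation_centred[OF predictable_arm[OF t J(2)]])
    finally show "(\<integral>\<omega>. g (x \<omega>) * D \<omega> \<partial>M) = 0" by simp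
  qed
  have 2: "integrable M (\<lambda>\<omega>. G (x \<omega>) * G (D \<omega>))"
    "(\<integral>\<omega>. G (x \<omega>) * G (D \<omega>) \<partial>M) \<le> m * (\<integral>\<omega>. G (x \<omega>) \<partial>M)"
  proof -
    have s: "(\<lambda>\<omega>. G (x \<omega>)) \<in> borel_measurable (stage_algebra ?J)" by simp
    show "integrable M (\<lambda>\<omega>. G (x \<omega>) * G (D \<omega>))"
      unfolding D_def innovation_def
      by (rule integrable_chosen_copy[OF s Gx ts _ _ J, of "\<lambda>k x. G (x - mean k)"]) (use X(1) in \<open>auto simp: G_def\<close>)
    have "(\<integral>\<omega>. G (x \<omega>) * G (D \<omega>) \<partial>M)
        = (\<integral>\<omega>. G (x \<omega>) * (\<integral>\<omega>'. G (X (t (Suc n) \<omega>) \<omega>' - mean (t (Suc n) \<omega>)) \<partial>M) \<partial>M)"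
      unfolding D_def innovation_def
      by (rule integral_chosen_copy[OF s Gx ts _ _ J, of "\<lambda>k x. G (x - mean k)"]) (use X(1) in \<open>auto simp: G_def\<close>)
    also have "\<dots> \<le> (\<integral>\<omega>. G (x \<omega>) * m \<partial>M)"
    proof (rule integral_mono')
      show "integrable M (\<lambda>\<omega>. G (x \<omega>) * m)" using Gx by simp
      fix \<omega> assume w: "\<omega> \<in> space M"
      show "G (x \<omega>) * (\<integral>\<omega>'. G (X (t (Suc n) \<omega>) \<omega>' - mean (t (Suc n) \<omega>)) \<partial>M) \<le> G (x \<omega>) * m"
        using X(2)[OF predictable_arm[OF t J(2) w]] by (intro mult_left_mono) (auto simp: G_def)
      show "0 \<le> G (x \<omega>) * m"
        using order_trans[OF integral_nonneg_AE X(2)[OF predictable_arm[OF t J(2) w]]] by (simp add: G_def)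
    qed
    finally show "(\<integral>\<omega>. G (x \<omega>) * G (D \<omega>) \<partial>M) \<le> m * (\<integral>\<omega>. G (x \<omega>) \<partial>M)" by (simp add: mult.commute)
  qed
  \<comment> \<open>An integrable pointwise majorant of the next power, so that integrability is
    propagated together with the bound; its middle term integrates to 0.\<close>
  define U where "U \<omega> = G (x \<omega>) + c * (g (x \<omega>) * D \<omega>) + C * c\<^sup>2 * (G (x \<omega>) * G (D \<omega>))" for \<omega>
  have U: "integrable M U" unfolding U_def using Gx 1 2 by auto
  have sum: "c * centred_sum t (Suc n) \<omega> = x \<omega> + c * D \<omega>" for \<omega>
    by (simp add: centred_sum_def x_def D_def algebra_simps)
  have le: "G (c * centred_sum t (Suc n) \<omega>) \<le> U \<omega>" for \<omega>
  proof -
    let ?d = "D \<omega>"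
    have "(1 + (c * ?d)\<^sup>2) powr (q - 1) * (c * ?d)\<^sup>2 \<le> (1 + ?d\<^sup>2) powr (q - 1) * (c\<^sup>2 * (1 + ?d\<^sup>2))"
    proof (intro mult_mono powr_mono2)
      have "c\<^sup>2 * ?d\<^sup>2 \<le> 1 * ?d\<^sup>2" using c by (intro mult_right_mono) (auto simp: power_le_one)
      then show "1 + (c * ?d)\<^sup>2 \<le> 1 + ?d\<^sup>2" by (simp add: power_mult_distrib)
      show "(c * ?d)\<^sup>2 \<le> c\<^sup>2 * (1 + ?d\<^sup>2)" by (simp add: power_mult_distrib algebra_simps)
    qed (use q in auto)
    also have "\<dots> = c\<^sup>2 * ((1 + ?d\<^sup>2) * (1 + ?d\<^sup>2) powr (q - 1))" by simp
    also have "(1 + ?d\<^sup>2) * (1 + ?d\<^sup>2) powr (q - 1) = G ?d"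
      by (simp add: powr_mult_base G_def)
    finally have "C * G (x \<omega>) * ((1 + (c * ?d)\<^sup>2) powr (q - 1) * (c * ?d)\<^sup>2) \<le> C * G (x \<omega>) * (c\<^sup>2 * G ?d)"
      using g(1) by (intro mult_left_mono) (auto simp: G_def)
    then show ?thesis
      using g(4)[of "x \<omega>" "c * ?d"] unfolding sum U_def by (simp add: G_def algebra_simps)
  qed
  have [measurable]: "centred_sum t (Suc n) \<in> borel_measurable M"
    by (rule measurable_centred_sum_M[OF t])
  have "integrable M (\<lambda>\<omega>. G (c * centred_sum t (Suc n) \<omega>))"
  proof (rule Bochner_Integration.integrable_bound[OF U])
    show "AE \<omega> in M. norm (G (c * centred_sum t (Suc n) \<omega>)) \<le> norm (U \<omega>)"
      using le by (intro AE_I2) (simp add: G_def order_trans[OF _ abs_ge_self])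
  qed simp
  then show "integrable M (\<lambda>\<omega>. (1 + (c * centred_sum t (Suc n) \<omega>)\<^sup>2) powr q)"
    by (simp add: G_def)
  then have "(\<integral>\<omega>. G (c * centred_sum t (Suc n) \<omega>) \<partial>M) \<le> (\<integral>\<omega>. U \<omega> \<partial>M)"
    using U le by (intro integral_mono) (simp_all add: G_def)
  also have "\<dots> = (\<integral>\<omega>. G (x \<omega>) \<partial>M) + C * c\<^sup>2 * (\<integral>\<omega>. G (x \<omega>) * G (D \<omega>) \<partial>M)"
    unfolding U_def using Gx 1 2 by simp
  also have "\<dots> \<le> (\<integral>\<omega>. G (x \<omega>) \<partial>M) + C * c\<^sup>2 * (m * (\<integral>\<omega>. G (x \<omega>) \<partial>M))"
    using 2 g(1) by (intro add_left_mono mult_left_mono) auto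
  also have "\<dots> = (1 + C * m * c\<^sup>2) * (\<integral>\<omega>. G (x \<omega>) \<partial>M)" by (simp add: algebra_simps)
  finally show "(\<integral>\<omega>. (1 + (c * centred_sum t (Suc n) \<omega>)\<^sup>2) powr q \<partial>M)
      \<le> (1 + C * m * c\<^sup>2) * (\<integral>\<omega>. (1 + (c * centred_sum t n \<omega>)\<^sup>2) powr q \<partial>M)"
    by (simp add: G_def x_def)
qed

text \<open>With \<open>c = 1 / sqrt n\<close> each of the \<open>n\<close> stages multiplies the
  moment by at most \<open>1 + C * m / n\<close>, so the product stays below
  \<open>exp (C * m)\<close> for every horizon and every strategy.\<close>

lemma centred_sum_moments_bounded:
  assumes q: "q \<ge> 1" and X: "\<And>k. k \<in> {1..K} \<Longrightarrow> integrable M (\<lambda>\<omega>. (1 + (X k \<omega> - mean k)\<^sup>2) powr q)"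
  obtains A where
    "\<And>t n. predictable t \<Longrightarrow> n \<ge> 1 \<Longrightarrow> integrable M (\<lambda>\<omega>. (1 + (1 / sqrt n * centred_sum t n \<omega>)\<^sup>2) powr q)"
    "\<And>t n. predictable t \<Longrightarrow> n \<ge> 1 \<Longrightarrow> (\<integral>\<omega>. (1 + (1 / sqrt n * centred_sum t n \<omega>)\<^sup>2) powr q \<partial>M) \<le> A"
proof -
  obtain C g where g: "C \<ge> 0" "continuous_on UNIV g" "\<And>x. \<bar>g x\<bar> \<le> C * (1 + x\<^sup>2) powr q"
    "\<And>x d. (1 + (x + d)\<^sup>2) powr q
       \<le> (1 + x\<^sup>2) powr q + g x * d + C * (1 + x\<^sup>2) powr q * ((1 + d\<^sup>2) powr (q - 1) * d\<^sup>2)"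
    using one_plus_square_powr_increment[OF q] by blast
  define m where "m = (\<Sum>k\<in>{1..K}. \<integral>\<omega>. (1 + (X k \<omega> - mean k)\<^sup>2) powr q \<partial>M)"
  have m: "(\<integral>\<omega>. (1 + (X k \<omega> - mean k)\<^sup>2) powr q \<partial>M) \<le> m" if "k \<in> {1..K}" for k
    unfolding m_def using that by (intro member_le_sum) auto
  have m0: "0 \<le> m" unfolding m_def by (intro sum_nonneg) auto
  \<comment> \<open>The scale \<open>c\<close> stays fixed while the number of summands grows; it is
    tied to the horizon only afterwards.\<close>
  have main: "integrable M (\<lambda>\<omega>. (1 + (c * centred_sum t n \<omega>)\<^sup>2) powr q) \<and>
      (\<integral>\<omega>. (1 + (c * centred_sum t n \<omega>)\<^sup>2) powr q \<partial>M) \<le> (1 + C * m * c\<^sup>2) ^ n"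
    if t: "predictable t" and c: "0 \<le> c" "c \<le> 1" for t n c
  proof (induction n)
    case 0
    then show ?case by (simp add: centred_sum_def prob_space)
  next
    case (Suc n)
    note step = centred_sum_moment_step[OF g q X m t c conjunct1[OF Suc.IH]]
    have "(1 + C * m * c\<^sup>2) * (\<integral>\<omega>. (1 + (c * centred_sum t n \<omega>)\<^sup>2) powr q \<partial>M) \<le> (1 + C * m * c\<^sup>2) ^ Suc n"
      using Suc.IH m0 g(1) by (simp add: mult_left_mono)
    then show ?case using step by fastforce
  qed
  show thesis
  proof (rule that)
    fix t :: "nat \<Rightarrow> 'a \<Rightarrow> nat" and n :: nat assume t: "predictable t" "n \<ge> 1"
    have c: "0 \<le> 1 / sqrt n" "1 / sqrt n \<le> 1" using t(2) by auto
    show "integrable M (\<lambda>\<omega>. (1 + (1 / sqrt n * centred_sum t n \<omega>)\<^sup>2) powr q)"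
      using main[OF t(1) c] by blast
    have "(\<integral>\<omega>. (1 + (1 / sqrt n * centred_sum t n \<omega>)\<^sup>2) powr q \<partial>M) \<le> (1 + C * m / n) ^ n"
      using main[OF t(1) c, of n] by (simp add: power_divide)
    also have "\<dots> \<le> exp (C * m / n) ^ n"
      using g(1) m0 by (intro power_mono exp_ge_add_one_self) auto
    also have "\<dots> = exp (C * m)" using t(2) by (simp flip: exp_of_nat_mult)
    finally show "(\<integral>\<omega>. (1 + (1 / sqrt n * centred_sum t n \<omega>)\<^sup>2) powr q \<partial>M) \<le> exp (C * m)" .
  qed
qed

end

subsection \<open>Lindeberg exchange\<close>

context bandit
begin

text \<open>A Lindeberg-type quantity. The minimum merges the two bounds on the variation of a
  bounded Lipschitz second derivative, twice its supremum and linear in the step. It therefore tends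
  to 0 with \<open>c\<close> by dominated convergence with finite variances only. Summing over the
  arms gives a bound valid for any choice.\<close>

definition truncated_second_moment :: "real \<Rightarrow> real" where
  "truncated_second_moment c = (\<Sum>k\<in>{1..K}. \<integral>\<omega>. min 2 (c * \<bar>X k \<omega> - mean k\<bar>) * (X k \<omega> - mean k)\<^sup>2 \<partial>M)"

lemma truncated_second_moment_integrable:
  assumes "k \<in> {1..K}" "c \<ge> 0"
  shows "integrable M (\<lambda>\<omega>. min 2 (c * \<bar>X k \<omega> - mean k\<bar>) * (X k \<omega> - mean k)\<^sup>2)"
proof (rule Bochner_Integration.integrable_bound)
  show "integrable M (\<lambda>\<omega>. 2 * (X k \<omega> - mean k)\<^sup>2)"
    using integrable_centred_square[OF assms(1)] by simp
  show "AE \<omega> in M. norm (min 2 (c * \<bar>X k \<omega> - mean k\<bar>) * (X k \<omega> - mean k)\<^sup>2) \<le> norm (2 * (X k \<omega> - mean k)\<^sup>2)"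
    using assms(2) by (intro AE_I2) (auto simp: abs_mult intro!: mult_right_mono)
qed (use measurable_payoff assms in measurable)

lemma truncated_second_moment_tendsto_0:
  "(\<lambda>n. truncated_second_moment (1 / sqrt (real n))) \<longlonglongrightarrow> 0"
proof -
  have "(\<lambda>n. \<integral>\<omega>. min 2 (1 / sqrt (real n) * \<bar>X k \<omega> - mean k\<bar>) * (X k \<omega> - mean k)\<^sup>2 \<partial>M) \<longlonglongrightarrow> (\<integral>\<omega>. 0 \<partial>M)"
    if k: "k \<in> {1..K}" for k
  proof (rule integral_dominated_convergence)
    show "integrable M (\<lambda>\<omega>. 2 * (X k \<omega> - mean k)\<^sup>2)"
      using integrable_centred_square[OF k] by simp
    show "AE \<omega> in M. norm (min 2 (1 / sqrt (real n) * \<bar>X k \<omega> - mean k\<bar>) * (X k \<omega> - mean k)\<^sup>2)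
        \<le> 2 * (X k \<omega> - mean k)\<^sup>2" for n
      by (intro AE_I2) (auto simp: abs_mult intro!: mult_right_mono)
    show "AE \<omega> in M. (\<lambda>n. min 2 (1 / sqrt (real n) * \<bar>X k \<omega> - mean k\<bar>) * (X k \<omega> - mean k)\<^sup>2) \<longlonglongrightarrow> 0"
    proof (rule AE_I2)
      fix \<omega>
      have "(\<lambda>n. 1 / sqrt (real n)) \<longlonglongrightarrow> 0"
        by (rule real_tendsto_divide_at_top[OF tendsto_const])
          (rule filterlim_compose[OF sqrt_at_top filterlim_real_sequentially])
      then have "(\<lambda>n. min 2 (1 / sqrt (real n) * \<bar>X k \<omega> - mean k\<bar>) * (X k \<omega> - mean k)\<^sup>2)
          \<longlonglongrightarrow> min 2 (0 * \<bar>X k \<omega> - mean k\<bar>) * (X k \<omega> - mean k)\<^sup>2"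
        by (intro tendsto_intros)
      then show "(\<lambda>n. min 2 (1 / sqrt (real n) * \<bar>X k \<omega> - mean k\<bar>) * (X k \<omega> - mean k)\<^sup>2) \<longlonglongrightarrow> 0"
        by simp
    qed
  qed (use measurable_payoff k in measurable)
  then have "(\<lambda>n. truncated_second_moment (1 / sqrt (real n))) \<longlonglongrightarrow> (\<Sum>k\<in>{1..K}. 0)"
    unfolding truncated_second_moment_def by (intro tendsto_sum) simp
  then show ?thesis by simp
qed

lemma innovation_integrable:
  assumes "t i \<in> stage_algebra J \<rightarrow>\<^sub>M count_space {1..K}" "J \<subseteq> {1..}" "i \<ge> 1" "i \<notin> J"
  shows "integrable M (innovation t i)"
proof -
  have "integrable M (\<lambda>\<omega>. 1 * (Y (t i \<omega>) i \<omega> - mean (t i \<omega>)))"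
    by (rule integrable_chosen_copy[OF _ _ assms(1) _ _ assms(2-4), of "\<lambda>_. 1" "\<lambda>k x. x - mean k"])
      (use integrable_payoff in auto)
  then show ?thesis by (simp add: innovation_def[abs_def])
qed

text \<open>Expands \<open>g\<close> to second order at the contribution \<open>b\<close> of the
  other stages. The set \<open>J\<close> is any set of stages avoiding \<open>i\<close>, not just
  the past, because in the exchange \<open>b\<close> also contains later stages. The centred
  increment removes the first-order term, and its square contributes the variance of the chosen
  arm.\<close>

lemma lindeberg_step:
  assumes g: "\<And>x. (g has_real_derivative g1 x) (at x)" "\<And>x. (g1 has_real_derivative g2 x) (at x)"
    and bd: "\<And>x. \<bar>g1 x\<bar> \<le> L" "\<And>x. \<bar>g2 x\<bar> \<le> B" "\<And>x y. \<bar>g2 x - g2 y\<bar> \<le> B * \<bar>x - y\<bar>"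
    and b: "b \<in> borel_measurable (stage_algebra J)" "integrable M b"
    and ts: "t i \<in> stage_algebra J \<rightarrow>\<^sub>M count_space {1..K}"
    and J: "J \<subseteq> {1..}" "i \<ge> 1" "i \<notin> J" and c: "c \<ge> 0"
  shows "integrable M (\<lambda>\<omega>. g2 (c * b \<omega>) * var (t i \<omega>))"
    and "\<bar>(\<integral>\<omega>. g (c * (b \<omega> + innovation t i \<omega>)) \<partial>M) - (\<integral>\<omega>. g (c * b \<omega>) \<partial>M)
        - c\<^sup>2 / 2 * (\<integral>\<omega>. g2 (c * b \<omega>) * var (t i \<omega>) \<partial>M)\<bar> \<le> c\<^sup>2 * B * truncated_second_moment c"
proof -
  define D where "D = innovation t i"
  have B: "B \<ge> 0" using bd(2)[of 0] by simp
  have D: "integrable M D" unfolding D_def by (rule innovation_integrable[of t i, OF ts J])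
  have cont: "continuous_on UNIV g" "continuous_on UNIV g1"
    using g by (auto intro: DERIV_isCont continuous_at_imp_continuous_on)
  have "B-lipschitz_on UNIV g2"
    using bd(3) B by (auto simp: lipschitz_on_def dist_real_def)
  then have "continuous_on UNIV g2" by (rule lipschitz_on_continuous_on)
  then have [measurable]: "g \<in> borel_measurable borel" "g1 \<in> borel_measurable borel" "g2 \<in> borel_measurable borel"
    using cont by (auto intro: borel_measurable_continuous_onI)
  have [measurable]: "b \<in> borel_measurable M" "D \<in> borel_measurable M"
    using b(2) D by auto
  \<comment> \<open>A bounded derivative gives linear growth, so integrability of \<open>b\<close>
    and of the innovation makes \<open>g\<close> of them integrable.\<close>
  have g_growth: "\<bar>g x\<bar> \<le> \<bar>g 0\<bar> + L * \<bar>x\<bar>" for x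
  proof -
    have "norm (g x - g 0) \<le> L * norm (x - 0)"
      by (rule field_differentiable_bound[of UNIV g g1]) (use g(1) bd(1) in auto)
    then show ?thesis by simp
  qed
  have gi: "integrable M (\<lambda>\<omega>. g (f \<omega>))" if f: "integrable M f" for f
  proof (rule Bochner_Integration.integrable_bound)
    show "integrable M (\<lambda>\<omega>. \<bar>g 0\<bar> + L * \<bar>f \<omega>\<bar>)" using f by auto
    show "AE \<omega> in M. norm (g (f \<omega>)) \<le> norm (\<bar>g 0\<bar> + L * \<bar>f \<omega>\<bar>)"
      using g_growth by (intro AE_I2) (simp add: order_trans[OF _ abs_ge_self])
  qed (use f in auto)
  have g1i: "integrable M (\<lambda>\<omega>. g1 (c * b \<omega>))"
    by (rule integrable_const_bound[where B = L]) (use bd(1) in auto)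
  have g2i: "integrable M (\<lambda>\<omega>. g2 (c * b \<omega>))"
    by (rule integrable_const_bound[where B = B]) (use bd(2) in auto)
  note arm = measurable_space[OF ts, simplified]
  have 1: "integrable M (\<lambda>\<omega>. g1 (c * b \<omega>) * D \<omega>)" "(\<integral>\<omega>. g1 (c * b \<omega>) * D \<omega> \<partial>M) = 0"
  proof -
    have s: "(\<lambda>\<omega>. g1 (c * b \<omega>)) \<in> borel_measurable (stage_algebra J)" using b(1) by simp
    show "integrable M (\<lambda>\<omega>. g1 (c * b \<omega>) * D \<omega>)"
      unfolding D_def innovation_def
      by (rule integrable_chosen_copy[OF s g1i ts _ _ J, of "\<lambda>k x. x - mean k"]) (use integrable_payoff in auto)
    have "(\<integral>\<omega>. g1 (c * b \<omega>) * D \<omega> \<partial>M) = (\<integral>\<omega>. g1 (c * b \<omega>) * (\<integral>\<omega>'. X (t i \<omega>) \<omega>' - mean (t i \<omega>) \<partial>M) \<partial>M)"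
      unfolding D_def innovation_def
      by (rule integral_chosen_copy[OF s g1i ts _ _ J, of "\<lambda>k x. x - mean k"]) (use integrable_payoff in auto)
    also have "\<dots> = (\<integral>\<omega>. g1 (c * b \<omega>) * 0 \<partial>M)"
      using arm by (intro Bochner_Integration.integral_cong refl) (simp add: expectation_centred)
    finally show "(\<integral>\<omega>. g1 (c * b \<omega>) * D \<omega> \<partial>M) = 0" by simp
  qed
  have 2: "integrable M (\<lambda>\<omega>. g2 (c * b \<omega>) * (D \<omega>)\<^sup>2)"
    "(\<integral>\<omega>. g2 (c * b \<omega>) * (D \<omega>)\<^sup>2 \<partial>M) = (\<integral>\<omega>. g2 (c * b \<omega>) * var (t i \<omega>) \<partial>M)"
  proof -
    have s: "(\<lambda>\<omega>. g2 (c * b \<omega>)) \<in> borel_measurable (stage_algebra J)" using b(1) by simp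
    show "integrable M (\<lambda>\<omega>. g2 (c * b \<omega>) * (D \<omega>)\<^sup>2)"
      unfolding D_def innovation_def
      by (rule integrable_chosen_copy[OF s g2i ts _ _ J, of "\<lambda>k x. (x - mean k)\<^sup>2"])
        (use integrable_centred_square in auto)
    have "(\<integral>\<omega>. g2 (c * b \<omega>) * (D \<omega>)\<^sup>2 \<partial>M)
        = (\<integral>\<omega>. g2 (c * b \<omega>) * (\<integral>\<omega>'. (X (t i \<omega>) \<omega>' - mean (t i \<omega>))\<^sup>2 \<partial>M) \<partial>M)"
      unfolding D_def innovation_def
      by (rule integral_chosen_copy[OF s g2i ts _ _ J, of "\<lambda>k x. (x - mean k)\<^sup>2"])
        (use integrable_centred_square in auto)
    then show "(\<integral>\<omega>. g2 (c * b \<omega>) * (D \<omega>)\<^sup>2 \<partial>M) = (\<integral>\<omega>. g2 (c * b \<omega>) * var (t i \<omega>) \<partial>M)"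
      by (simp add: arm_var_def arm_mean_def)
  qed
  define \<rho> where "\<rho> \<omega> = min 2 (c * \<bar>D \<omega>\<bar>) * (D \<omega>)\<^sup>2" for \<omega>
  have 3: "integrable M \<rho>" "(\<integral>\<omega>. \<rho> \<omega> \<partial>M) \<le> truncated_second_moment c"
  proof -
    let ?h = "\<lambda>k x. min 2 (c * \<bar>x - mean k\<bar>) * (x - mean k)\<^sup>2"
    have "integrable M (\<lambda>\<omega>. 1 * ?h (t i \<omega>) (Y (t i \<omega>) i \<omega>))"
      by (rule integrable_chosen_copy[OF _ _ ts _ _ J, of "\<lambda>_. 1" ?h])
        (use truncated_second_moment_integrable c in auto)
    then show "integrable M \<rho>" by (simp add: \<rho>_def[abs_def] D_def innovation_def)
    have "(\<integral>\<omega>. 1 * ?h (t i \<omega>) (Y (t i \<omega>) i \<omega>) \<partial>M) = (\<integral>\<omega>. 1 * (\<integral>\<omega>'. ?h (t i \<omega>) (X (t i \<omega>) \<omega>') \<partial>M) \<partial>M)"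
      by (rule integral_chosen_copy[OF _ _ ts _ _ J, of "\<lambda>_. 1" ?h])
        (use truncated_second_moment_integrable c in auto)
    also have "\<dots> \<le> (\<integral>\<omega>. truncated_second_moment c \<partial>M)"
    proof (rule integral_mono')
      fix \<omega> assume "\<omega> \<in> space M"
      from arm[OF this] show "1 * (\<integral>\<omega>'. ?h (t i \<omega>) (X (t i \<omega>) \<omega>') \<partial>M) \<le> truncated_second_moment c"
        unfolding truncated_second_moment_def mult_1 using c
        by (intro member_le_sum[of "t i \<omega>" "{1..K}" "\<lambda>k. \<integral>\<omega>. ?h k (X k \<omega>) \<partial>M"]) auto
      show "0 \<le> truncated_second_moment c"
        unfolding truncated_second_moment_def using c by (intro sum_nonneg integral_nonneg_AE) auto
    qed simp
    finally show "(\<integral>\<omega>. \<rho> \<omega> \<partial>M) \<le> truncated_second_moment c"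
      by (simp add: \<rho>_def D_def innovation_def prob_space)
  qed
  define R where "R \<omega> = g (c * (b \<omega> + D \<omega>)) - g (c * b \<omega>) - c * (g1 (c * b \<omega>) * D \<omega>)
      - c\<^sup>2 / 2 * (g2 (c * b \<omega>) * (D \<omega>)\<^sup>2)" for \<omega>
  have gb: "integrable M (\<lambda>\<omega>. g (c * b \<omega>))" "integrable M (\<lambda>\<omega>. g (c * (b \<omega> + D \<omega>)))"
    using b(2) D by (auto intro!: gi)
  have R: "integrable M R" unfolding R_def using gb 1(1) 2(1) by auto
  have R_le: "\<bar>R \<omega>\<bar> \<le> c\<^sup>2 * B * \<rho> \<omega>" for \<omega>
  proof -
    obtain z where z: "\<bar>z - c * b \<omega>\<bar> \<le> \<bar>c * D \<omega>\<bar>"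
      "g (c * b \<omega> + c * D \<omega>) = g (c * b \<omega>) + g1 (c * b \<omega>) * (c * D \<omega>) + g2 z * (c * D \<omega>)\<^sup>2 / 2"
      using second_order_taylor[OF g] by blast
    \<comment> \<open>The expansion has its second derivative at an intermediate point
      \<open>z\<close>; subtracting the same term at \<open>c * b \<omega>\<close> leaves only the
      variation of \<open>g2\<close>, which is small for small steps and bounded for large
      ones.\<close>
    have eqR: "R \<omega> = (g2 z - g2 (c * b \<omega>)) * (c\<^sup>2 * (D \<omega>)\<^sup>2 / 2)"
      using z(2) by (simp add: R_def algebra_simps power_mult_distrib diff_divide_distrib)
    have "\<bar>g2 z - g2 (c * b \<omega>)\<bar> \<le> B * min 2 (c * \<bar>D \<omega>\<bar>)"
    proof -
      have "\<bar>g2 z - g2 (c * b \<omega>)\<bar> \<le> B * 2"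
        using bd(2)[of z] bd(2)[of "c * b \<omega>"] by (simp add: abs_le_iff)
      moreover have "B * \<bar>z - c * b \<omega>\<bar> \<le> B * (c * \<bar>D \<omega>\<bar>)"
        using z(1) B c by (intro mult_left_mono) (auto simp: abs_mult)
      then have "\<bar>g2 z - g2 (c * b \<omega>)\<bar> \<le> B * (c * \<bar>D \<omega>\<bar>)"
        using bd(3)[of z "c * b \<omega>"] by simp
      ultimately show ?thesis by (simp add: min_def)
    qed
    then have "\<bar>R \<omega>\<bar> \<le> (B * min 2 (c * \<bar>D \<omega>\<bar>)) * \<bar>c\<^sup>2 * (D \<omega>)\<^sup>2 / 2\<bar>"
      unfolding eqR abs_mult[of "g2 z - g2 (c * b \<omega>)"] by (rule mult_right_mono) simp
    also have "\<dots> = c\<^sup>2 * B * \<rho> \<omega> / 2" by (simp add: \<rho>_def)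
    also have "\<dots> \<le> c\<^sup>2 * B * \<rho> \<omega>"
      using B c by (simp add: \<rho>_def)
    finally show ?thesis .
  qed
  have "\<bar>\<integral>\<omega>. R \<omega> \<partial>M\<bar> \<le> (\<integral>\<omega>. \<bar>R \<omega>\<bar> \<partial>M)" by (rule integral_abs_bound)
  also have "\<dots> \<le> (\<integral>\<omega>. c\<^sup>2 * B * \<rho> \<omega> \<partial>M)"
    using R 3(1) R_le by (intro integral_mono) auto
  also have "\<dots> \<le> c\<^sup>2 * B * truncated_second_moment c"
    using 3(2) B by (simp add: mult_left_mono)
  finally have "\<bar>\<integral>\<omega>. R \<omega> \<partial>M\<bar> \<le> c\<^sup>2 * B * truncated_second_moment c" .
  moreover have "(\<integral>\<omega>. R \<omega> \<partial>M) = (\<integral>\<omega>. g (c * (b \<omega> + D \<omega>)) \<partial>M) - (\<integral>\<omega>. g (c * b \<omega>) \<partial>M)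
      - c\<^sup>2 / 2 * (\<integral>\<omega>. g2 (c * b \<omega>) * var (t i \<omega>) \<partial>M)"
    unfolding R_def using gb 1 2 by simp
  ultimately show "\<bar>(\<integral>\<omega>. g (c * (b \<omega> + innovation t i \<omega>)) \<partial>M) - (\<integral>\<omega>. g (c * b \<omega>) \<partial>M)
        - c\<^sup>2 / 2 * (\<integral>\<omega>. g2 (c * b \<omega>) * var (t i \<omega>) \<partial>M)\<bar> \<le> c\<^sup>2 * B * truncated_second_moment c"
    by (simp add: D_def)
  have mv [measurable]: "(\<lambda>\<omega>. var (t i \<omega>)) \<in> borel_measurable M"
    using measurable_stage_algebra_imp[OF measurable_compose[OF ts, of var borel] J(1)] by simp
  have "norm (var (t i \<omega>)) \<le> Max ((\<lambda>k. norm (var k)) ` {1..K})" if "\<omega> \<in> space M" for \<omega>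
    using arm[OF that] by (intro Max_ge) auto
  then have "integrable M (\<lambda>\<omega>. var (t i \<omega>))"
    by (intro integrable_const_bound[OF AE_I2 mv])
  then have "integrable M (\<lambda>\<omega>. B * var (t i \<omega>))" by simp
  then show "integrable M (\<lambda>\<omega>. g2 (c * b \<omega>) * var (t i \<omega>))"
  proof (rule Bochner_Integration.integrable_bound)
    show "AE \<omega> in M. norm (g2 (c * b \<omega>) * var (t i \<omega>)) \<le> norm (B * var (t i \<omega>))"
      using bd(2) B by (intro AE_I2) (simp add: abs_mult mult_right_mono)
  qed measurable
qed

text \<open>Lindeberg exchange on the given space: replace the choices of the stages \<open>n, n - 1, \<dots>, 1\<close> one
  after the other by the arm \<open>k\<close>. The sum of the innovations of the other stages does not involve
  the copies of the stage being exchanged.\<close>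

lemma lindeberg_exchange:
  fixes n :: nat
  assumes g: "\<And>x. (g has_real_derivative g1 x) (at x)" "\<And>x. (g1 has_real_derivative g2 x) (at x)"
    and bd: "\<And>x. \<bar>g1 x\<bar> \<le> L" "\<And>x. \<bar>g2 x\<bar> \<le> B" "\<And>x y. \<bar>g2 x - g2 y\<bar> \<le> B * \<bar>x - y\<bar>"
    and t: "predictable t" and k: "k \<in> {1..K}" and c: "c \<ge> 0"
  defines "E \<equiv> \<lambda>s. \<integral>\<omega>. g (c * centred_sum s n \<omega>) \<partial>M"
  defines "e \<equiv> real n * (2 * c\<^sup>2 * B * truncated_second_moment c)"
  shows "\<lbrakk>\<And>x. g2 x \<le> 0; \<And>j. j \<in> {1..K} \<Longrightarrow> var k \<le> var j\<rbrakk> \<Longrightarrow> E t - E (\<lambda>n \<omega>. k) \<le> e"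
    and "\<lbrakk>\<And>j \<omega>. j \<ge> 1 \<Longrightarrow> \<omega> \<in> space M \<Longrightarrow> var (t j \<omega>) = var k\<rbrakk> \<Longrightarrow> \<bar>E t - E (\<lambda>n \<omega>. k)\<bar> \<le> e"
proof -
  \<comment> \<open>A hybrid: \<open>t\<close> up to stage \<open>i\<close> and the arm
    \<open>k\<close> afterwards. Thus \<open>s 0\<close> is the constant strategy,
    \<open>s n\<close> agrees with \<open>t\<close> on all stages of the horizon, and neighbouring
    hybrids differ at a single stage.\<close>
  define s where "s i j = (if j \<le> i then t j else (\<lambda>\<omega>. k))" for i j
  define b where "b i \<omega> = (\<Sum>j\<in>{1..n} - {i}. innovation (s i) j \<omega>)" for i \<omega>
  \<comment> \<open>The difference of the second-order terms of \<open>t\<close> and of the arm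
    \<open>k\<close> at a common base point; up to the error this is the whole effect of one
    exchange.\<close>
  define V where "V i = c\<^sup>2 / 2 * (\<integral>\<omega>. g2 (c * b i \<omega>) * (var (t i \<omega>) - var k) \<partial>M)" for i
  \<comment> \<open>Twice the error of a single expansion: one for the choice of \<open>t\<close> at
    stage \<open>i\<close>, one for the arm \<open>k\<close>.\<close>
  let ?e = "2 * c\<^sup>2 * B * truncated_second_moment c"
  have step: "\<bar>E (s i) - E (s (i - 1)) - V i\<bar> \<le> ?e" if i: "i \<in> {1..n}" for i
  proof -
    let ?J = "{1..n} - {i}"
    have J: "?J \<subseteq> {1..}" "i \<ge> 1" "i \<notin> ?J" using i by auto
    \<comment> \<open>For \<open>j \<le> i\<close> the choice \<open>t j\<close> looks at stages
      below \<open>j\<close>, none of which is \<open>i\<close>; for later \<open>j\<close> it is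
      constant. This is why the exchanges must run from the last stage downwards.\<close>
    have ss: "s i j \<in> stage_algebra ?J \<rightarrow>\<^sub>M count_space {1..K}" if "j \<in> {1..n}" for j
      using that i k unfolding s_def by (auto intro!: predictableD[OF t])
    have sb: "b i \<in> borel_measurable (stage_algebra ?J)"
      unfolding b_def[abs_def] using ss by (intro borel_measurable_sum measurable_innovation) auto
    have ib: "integrable M (b i)"
      unfolding b_def[abs_def]
    proof (rule Bochner_Integration.integrable_sum)
      fix j assume "j \<in> ?J"
      then show "integrable M (innovation (s i) j)"
        using k by (intro innovation_integrable[of "s i" j "{1..<j}"])
          (auto simp: s_def intro!: predictableD[OF t])
    qed
    have sum1: "centred_sum (s i) n \<omega> = b i \<omega> + innovation t i \<omega>" for \<omega>
      unfolding centred_sum_def b_def using i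
      by (subst sum.remove[of _ i]) (auto simp: innovation_def s_def)
    have sum0: "centred_sum (s (i - 1)) n \<omega> = b i \<omega> + innovation (\<lambda>n \<omega>. k) i \<omega>" for \<omega>
    proof -
      have "(\<Sum>j\<in>{1..n} - {i}. innovation (s (i - 1)) j \<omega>) = b i \<omega>"
        unfolding b_def by (intro sum.cong refl) (auto simp: innovation_def s_def)
      moreover have "innovation (s (i - 1)) i \<omega> = innovation (\<lambda>n \<omega>. k) i \<omega>"
        using i by (auto simp: innovation_def s_def)
      ultimately show ?thesis
        unfolding centred_sum_def using i by (subst sum.remove[of _ i]) auto
    qed
    have ti: "t i \<in> stage_algebra ?J \<rightarrow>\<^sub>M count_space {1..K}"
      using i by (auto intro!: predictableD[OF t])
    have ki: "(\<lambda>\<omega>. k) \<in> stage_algebra ?J \<rightarrow>\<^sub>M count_space {1..K}" using k by simp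
    note L1 = lindeberg_step[where t = t and i = i, OF g bd sb ib ti J c]
    note L0 = lindeberg_step[where t = "\<lambda>n \<omega>. k" and i = i, OF g bd sb ib ki J c]
    have "V i = c\<^sup>2 / 2 * ((\<integral>\<omega>. g2 (c * b i \<omega>) * var (t i \<omega>) \<partial>M) - (\<integral>\<omega>. g2 (c * b i \<omega>) * var k \<partial>M))"
      unfolding V_def right_diff_distrib
      by (subst Bochner_Integration.integral_diff[OF L1(1) L0(1)]) (simp add: right_diff_distrib)
    then have "V i = c\<^sup>2 / 2 * (\<integral>\<omega>. g2 (c * b i \<omega>) * var (t i \<omega>) \<partial>M) - c\<^sup>2 / 2 * (\<integral>\<omega>. g2 (c * b i \<omega>) * var k \<partial>M)"
      by (simp only: right_diff_distrib)
    then show ?thesis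
      using L1(2) L0(2) unfolding E_def sum1 sum0 abs_le_iff by linarith
  qed
  have E0: "E (s 0) = E (\<lambda>n \<omega>. k)"
    unfolding E_def centred_sum_def by (intro arg_cong[of _ _ "integral\<^sup>L M"] ext arg_cong[of _ _ "\<lambda>x. g (c * x)"] sum.cong)
      (auto simp: s_def innovation_def)
  have En: "E (s n) = E t"
    unfolding E_def centred_sum_def by (intro arg_cong[of _ _ "integral\<^sup>L M"] ext arg_cong[of _ _ "\<lambda>x. g (c * x)"] sum.cong)
      (auto simp: s_def innovation_def)
  show "E t - E (\<lambda>n \<omega>. k) \<le> e" if neg: "\<And>x. g2 x \<le> 0" and kj: "\<And>j. j \<in> {1..K} \<Longrightarrow> var k \<le> var j"
  proof -
    have V: "V i \<le> 0" if "i \<in> {1..n}" for i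
    proof -
      have "0 \<le> (\<integral>\<omega>. - (g2 (c * b i \<omega>) * (var (t i \<omega>) - var k)) \<partial>M)"
        using neg kj predictable_arm[OF t] that
        by (intro integral_nonneg_AE AE_I2) (auto simp: mult_le_0_iff)
      then show ?thesis unfolding V_def by (simp add: mult_le_0_iff)
    qed
    have "i \<le> n \<Longrightarrow> E (s i) - E (s 0) \<le> real i * ?e" for i
    proof (induction i)
      case (Suc i)
      then show ?case
        using step[of "Suc i"] V[of "Suc i"] by (simp add: abs_le_iff algebra_simps)
    qed simp
    from this[of n] show ?thesis by (simp add: E0 En e_def)
  qed
  show "\<bar>E t - E (\<lambda>n \<omega>. k)\<bar> \<le> e" if eq: "\<And>j \<omega>. j \<ge> 1 \<Longrightarrow> \<omega> \<in> space M \<Longrightarrow> var (t j \<omega>) = var k"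
  proof -
    have V: "V i = 0" if "i \<in> {1..n}" for i
    proof -
      have "(\<integral>\<omega>. g2 (c * b i \<omega>) * (var (t i \<omega>) - var k) \<partial>M) = (\<integral>\<omega>. 0 \<partial>M)"
        using eq that by (intro Bochner_Integration.integral_cong refl) auto
      then show ?thesis by (simp add: V_def)
    qed
    have "i \<le> n \<Longrightarrow> \<bar>E (s i) - E (s 0)\<bar> \<le> real i * ?e" for i
    proof (induction i)
      case (Suc i)
      then show ?case
        using step[of "Suc i"] V[of "Suc i"] by (simp add: abs_le_iff algebra_simps)
    qed simp
    from this[of n] show ?thesis by (simp add: E0 En e_def)
  qed
qed

end

subsection \<open>Tails and the central limit theorem\<close>

lemma one_plus_square_powr_ge_1: "p \<ge> 0 \<Longrightarrow> 1 \<le> (1 + (w::real)\<^sup>2) powr p"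
  by (rule ge_one_powr_ge_zero) auto

lemma abs_le_one_plus_square_powr:
  assumes "q \<ge> (1::real)"
  shows "\<bar>w\<bar> \<le> (1 + w\<^sup>2) powr (q - 1/2)"
proof -
  have "\<bar>w\<bar> = sqrt (w\<^sup>2)" by simp
  also have "\<dots> \<le> sqrt (1 + w\<^sup>2)" by (intro real_sqrt_le_mono) simp
  also have "\<dots> = (1 + w\<^sup>2) powr (1/2)" by (simp add: powr_half_sqrt)
  also have "\<dots> \<le> (1 + w\<^sup>2) powr (q - 1/2)" using assms by (intro powr_mono) auto
  finally show ?thesis .
qed

text \<open>For \<open>R < \<bar>w\<bar>\<close> the root of \<open>1 + w\<^sup>2\<close> exceeds
  \<open>R\<close>, so the spare half power buys the factor \<open>1 / R\<close>.\<close>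

lemma one_plus_square_powr_tail:
  assumes "R > 0" "R < \<bar>w::real\<bar>"
  shows "(1 + w\<^sup>2) powr (q - 1/2) \<le> (1 + w\<^sup>2) powr q / R"
proof -
  have pos: "0 < 1 + w\<^sup>2" by (simp add: add_pos_nonneg)
  have "R \<le> sqrt (w\<^sup>2)" using assms by simp
  also have "\<dots> \<le> sqrt (1 + w\<^sup>2)" by (intro real_sqrt_le_mono) simp
  also have "\<dots> = (1 + w\<^sup>2) powr (1/2)" by (simp add: powr_half_sqrt)
  finally have "(1 + w\<^sup>2) powr (q - 1/2) * R \<le> (1 + w\<^sup>2) powr (q - 1/2) * (1 + w\<^sup>2) powr (1/2)"
    by (intro mult_left_mono) auto
  also have "\<dots> = (1 + w\<^sup>2) powr q" by (simp flip: powr_add)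
  finally show ?thesis using assms by (simp add: field_simps)
qed

context prob_space
begin

lemma integrable_growth:
  fixes f :: "real \<Rightarrow> real"
  assumes [measurable]: "W \<in> borel_measurable M" "f \<in> borel_measurable borel"
    and int: "integrable M (\<lambda>\<omega>. (1 + (W \<omega>)\<^sup>2) powr q)"
    and f: "\<And>w. \<bar>f w\<bar> \<le> C * (1 + w\<^sup>2) powr (q - 1/2)"
  shows "integrable M (\<lambda>\<omega>. f (W \<omega>))"
proof (rule Bochner_Integration.integrable_bound)
  show "integrable M (\<lambda>\<omega>. C * (1 + (W \<omega>)\<^sup>2) powr q)" using int by simp
  have C: "C \<ge> 0" using f[of 0] by simp
  show "AE \<omega> in M. norm (f (W \<omega>)) \<le> norm (C * (1 + (W \<omega>)\<^sup>2) powr q)"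
  proof (rule AE_I2)
    fix \<omega>
    have "C * (1 + (W \<omega>)\<^sup>2) powr (q - 1/2) \<le> C * (1 + (W \<omega>)\<^sup>2) powr q"
      using C by (intro mult_left_mono powr_mono) auto
    then show "norm (f (W \<omega>)) \<le> norm (C * (1 + (W \<omega>)\<^sup>2) powr q)"
      using f[of "W \<omega>"] C by simp
  qed
qed measurable

text \<open>One pointwise inequality covers both regions: \<open>\<epsilon>\<close> inside
  \<open>R\<close>, and outside the growth bound with half a power traded for \<open>1 / R\<close>.
  It serves the sums as well as the normal limit law.\<close>

lemma expectation_close:
  fixes f1 f2 :: "real \<Rightarrow> real"
  assumes meas: "W \<in> borel_measurable M" "f1 \<in> borel_measurable borel" "f2 \<in> borel_measurable borel"
    and int: "integrable M (\<lambda>\<omega>. (1 + (W \<omega>)\<^sup>2) powr q)"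
    and A: "(\<integral>\<omega>. (1 + (W \<omega>)\<^sup>2) powr q \<partial>M) \<le> A"
    and f1: "\<And>w. \<bar>f1 w\<bar> \<le> C * (1 + w\<^sup>2) powr (q - 1/2)"
    and f2: "\<And>w. \<bar>f2 w\<bar> \<le> C * (1 + w\<^sup>2) powr (q - 1/2)"
    and R: "R > 0" and close: "\<And>w. \<bar>w\<bar> \<le> R \<Longrightarrow> \<bar>f1 w - f2 w\<bar> \<le> \<epsilon>"
  shows "\<bar>(\<integral>\<omega>. f1 (W \<omega>) \<partial>M) - (\<integral>\<omega>. f2 (W \<omega>) \<partial>M)\<bar> \<le> \<epsilon> + 2 * C * A / R"
proof -
  have C: "C \<ge> 0" using f1[of 0] by simp
  have \<epsilon>: "\<epsilon> \<ge> 0" using close[of 0] R by simp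
  have i1: "integrable M (\<lambda>\<omega>. f1 (W \<omega>))" and i2: "integrable M (\<lambda>\<omega>. f2 (W \<omega>))"
    by (rule integrable_growth[OF meas(1,2) int f1], rule integrable_growth[OF meas(1,3) int f2])
  have pw: "\<bar>f1 w - f2 w\<bar> \<le> \<epsilon> + 2 * C / R * (1 + w\<^sup>2) powr q" for w
  proof (cases "\<bar>w\<bar> \<le> R")
    case True
    have "0 \<le> 2 * C / R * (1 + w\<^sup>2) powr q" using C R by simp
    then show ?thesis using close[OF True] by linarith
  next
    case False
    have "\<bar>f1 w - f2 w\<bar> \<le> 2 * C * (1 + w\<^sup>2) powr (q - 1/2)"
      using f1[of w] f2[of w] by (simp add: abs_le_iff)
    also have "\<dots> \<le> 2 * C * ((1 + w\<^sup>2) powr q / R)"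
      using one_plus_square_powr_tail[OF R, of w q] False C by (intro mult_left_mono) auto
    finally show ?thesis using \<epsilon> by simp
  qed
  have "\<bar>(\<integral>\<omega>. f1 (W \<omega>) \<partial>M) - (\<integral>\<omega>. f2 (W \<omega>) \<partial>M)\<bar> = \<bar>\<integral>\<omega>. f1 (W \<omega>) - f2 (W \<omega>) \<partial>M\<bar>"
    using i1 i2 by simp
  also have "\<dots> \<le> (\<integral>\<omega>. \<bar>f1 (W \<omega>) - f2 (W \<omega>)\<bar> \<partial>M)" by (rule integral_abs_bound)
  also have "\<dots> \<le> (\<integral>\<omega>. \<epsilon> + 2 * C / R * (1 + (W \<omega>)\<^sup>2) powr q \<partial>M)"
    using i1 i2 int pw by (intro integral_mono) auto
  also have "\<dots> = \<epsilon> + 2 * C / R * (\<integral>\<omega>. (1 + (W \<omega>)\<^sup>2) powr q \<partial>M)"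
    using int by (simp add: prob_space)
  also have "\<dots> \<le> \<epsilon> + 2 * C / R * A"
    using A C R by (intro add_left_mono mult_left_mono) auto
  finally show ?thesis by simp
qed

end

section \<open>The centred normal law and convergence to it\<close>

lemma sets_centred_normal [simp, measurable_cong]: "sets (centred_normal v) = sets borel"
  by (simp add: centred_normal_def)

lemma prob_space_centred_normal:
  assumes "v \<ge> 0"
  shows "prob_space (centred_normal v)"
  using assms prob_space_normal_density[of "sqrt v" 0]
  by (auto simp: centred_normal_def prob_space_return)

text \<open>The real exponent is rounded up to an integer, so that an even polynomial dominates and
  the known normal moments suffice; the Dirac case is bounded almost everywhere.\<close>

lemma integrable_centred_normal_powr:
  assumes "v \<ge> 0" "q \<ge> 0"
  shows "integrable (centred_normal v) (\<lambda>w. (1 + w\<^sup>2) powr q)"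
proof (cases "v = 0")
  case True
  interpret prob_space "return borel (0::real)" by (rule prob_space_return) simp
  have "integrable (return borel 0) (\<lambda>w::real. (1 + w\<^sup>2) powr q)"
    by (rule integrable_const_bound[where B = 1]) (auto simp: AE_return)
  then show ?thesis using True by (simp add: centred_normal_def)
next
  case False
  then have v: "v > 0" using assms by simp
  define m where "m = nat \<lceil>q\<rceil>"
  have m: "q \<le> real m" unfolding m_def using assms(2) by linarith
  have le: "(1 + w\<^sup>2) powr q \<le> 2 ^ m * (1 + w ^ (2 * m))" for w :: real
  proof -
    have "(1 + w\<^sup>2) powr q \<le> (1 + w\<^sup>2) powr m" using m by (intro powr_mono) auto
    also have "\<dots> = (1 + w\<^sup>2) ^ m" by (simp add: powr_realpow add_pos_nonneg)
    also have "\<dots> \<le> (2 * max 1 (w\<^sup>2)) ^ m" by (intro power_mono) auto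
    also have "\<dots> = 2 ^ m * max 1 (w\<^sup>2) ^ m" by (rule power_mult_distrib)
    also have "\<dots> \<le> 2 ^ m * (1 + w ^ (2 * m))"
      by (intro mult_left_mono) (auto simp: max_def power_mult)
    finally show ?thesis .
  qed
  have "integrable lborel (\<lambda>w. normal_density 0 (sqrt v) w * (2 ^ m * (1 + w ^ (2 * m))))"
  proof -
    have "integrable lborel (\<lambda>w. 2 ^ m * normal_density 0 (sqrt v) w
        + 2 ^ m * (normal_density 0 (sqrt v) w * (w - 0) ^ (2 * m)))"
      using v integrable_normal_moment[of "sqrt v" 0 "2 * m"] integrable_normal_density[of "sqrt v" 0] by auto
    then show ?thesis by (simp add: algebra_simps)
  qed
  then have "integrable lborel (\<lambda>w. normal_density 0 (sqrt v) w * (1 + w\<^sup>2) powr q)"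
    by (rule Bochner_Integration.integrable_bound)
      (use le normal_density_nonneg in \<open>auto simp: abs_mult intro!: mult_left_mono order_trans[OF le] abs_ge_self\<close>)
  then show ?thesis
    using False by (simp add: centred_normal_def integrable_density normal_density_nonneg)
qed

lemma integral_centred_normal_scale:
  fixes f :: "real \<Rightarrow> real"
  assumes "\<sigma> > 0" and [measurable]: "f \<in> borel_measurable borel"
  shows "(\<integral>y. f y \<partial>centred_normal (\<sigma>\<^sup>2)) = (\<integral>z. f (\<sigma> * z) \<partial>std_normal_distribution)"
proof -
  have "(\<integral>y. f y \<partial>centred_normal (\<sigma>\<^sup>2)) = (\<integral>y. normal_density 0 \<sigma> y * f y \<partial>lborel)"
    using assms(1) by (simp add: centred_normal_def integral_density normal_density_nonneg)
  also have "\<dots> = \<sigma> * (\<integral>z. normal_density 0 \<sigma> (\<sigma> * z) * f (\<sigma> * z) \<partial>lborel)"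
    using assms(1) by (subst lborel_integral_real_affine[of \<sigma> _ 0]) auto
  also have "\<dots> = (\<integral>z. \<sigma> * (normal_density 0 \<sigma> (\<sigma> * z) * f (\<sigma> * z)) \<partial>lborel)"
    by simp
  also have "\<dots> = (\<integral>z. std_normal_density z * f (\<sigma> * z) \<partial>lborel)"
    using assms(1) by (intro Bochner_Integration.integral_cong refl)
      (simp add: normal_density_def real_sqrt_mult power_mult_distrib)
  also have "\<dots> = (\<integral>z. f (\<sigma> * z) \<partial>std_normal_distribution)"
    by (simp add: integral_density normal_density_nonneg)
  finally show ?thesis .
qed

context bandit
begin

lemma var_nonneg: "k \<in> {1..K} \<Longrightarrow> var k \<ge> 0"
  by (simp add: arm_var_def)

text \<open>Shifts the stages, which start at 1, to a sequence indexed from 0 as the central limit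
  theorem expects. Singleton blocks are restricted and then projected.\<close>

lemma indep_vars_arm:
  assumes k: "k \<in> {1..K}"
  shows "indep_vars (\<lambda>_. borel) (\<lambda>i. Y k (Suc i)) UNIV"
proof -
  have "indep_vars (\<lambda>j. PiM {(k, Suc j)} (\<lambda>_. borel)) (\<lambda>j \<omega>. \<lambda>p\<in>{(k, Suc j)}. (case p of (k, n) \<Rightarrow> Y k n) \<omega>) UNIV"
    by (rule indep_vars_restrict[OF indep_copies]) (use k in \<open>auto simp: disjoint_family_on_def\<close>)
  then have "indep_vars (\<lambda>_. borel)
      (\<lambda>j \<omega>. (\<lambda>x. x (k, Suc j)) (\<lambda>p\<in>{(k, Suc j)}. (case p of (k, n) \<Rightarrow> Y k n) \<omega>)) UNIV"
    by (rule indep_vars_compose2) measurable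
  then show ?thesis by simp
qed

lemma centred_sum_const: "centred_sum (\<lambda>n \<omega>. k) n \<omega> = (\<Sum>i<n. Y k (Suc i) \<omega> - mean k)"
  unfolding centred_sum_def innovation_def
  by (rule sum.reindex_bij_witness[of _ Suc "\<lambda>i. i - 1"]) auto

text \<open>If the variance is 0, all innovations vanish almost everywhere and the limit is the
  Dirac mass. Otherwise the standard central limit theorem is applied to the rescaled test function
  \<open>\<lambda>z. f (\<sigma> * z)\<close>.\<close>

lemma clt_bounded:
  fixes f :: "real \<Rightarrow> real"
  assumes k: "k \<in> {1..K}" and f: "continuous_on UNIV f" "\<And>x. \<bar>f x\<bar> \<le> B"
  shows "(\<lambda>n. \<integral>\<omega>. f (1 / sqrt n * centred_sum (\<lambda>n \<omega>. k) n \<omega>) \<partial>M) \<longlonglongrightarrow> (\<integral>y. f y \<partial>centred_normal (var k))"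
proof -
  have [measurable]: "f \<in> borel_measurable borel" using f(1) by (rule borel_measurable_continuous_onI)
  have [measurable]: "Y k (Suc i) \<in> borel_measurable M" for i using measurable_copy[OF k, of "Suc i"] by simp
  have sq: "integrable M (\<lambda>\<omega>. (Y k (Suc n) \<omega> - mean k)\<^sup>2)"
    "(\<integral>\<omega>. (Y k (Suc n) \<omega> - mean k)\<^sup>2 \<partial>M) = var k" for n
    using integrable_copy[OF k, of "Suc n" "\<lambda>x. (x - mean k)\<^sup>2"] integrable_centred_square[OF k]
      integral_copy[OF k, of "Suc n" "\<lambda>x. (x - mean k)\<^sup>2"] by (auto simp: arm_var_def arm_mean_def)
  show ?thesis
  proof (cases "var k = 0")
    case True
    have "AE \<omega> in M. (Y k (Suc n) \<omega> - mean k)\<^sup>2 = 0" for n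
      using integral_nonneg_eq_0_iff_AE[OF sq(1)[of n]] sq(2)[of n] True by simp
    then have "AE \<omega> in M. \<forall>n. (Y k (Suc n) \<omega> - mean k)\<^sup>2 = 0" by (simp add: AE_all_countable)
    then have "AE \<omega> in M. centred_sum (\<lambda>n \<omega>. k) n \<omega> = 0" for n
      by eventually_elim (simp add: centred_sum_const)
    then have "(\<integral>\<omega>. f (1 / sqrt n * centred_sum (\<lambda>n \<omega>. k) n \<omega>) \<partial>M) = (\<integral>\<omega>. f 0 \<partial>M)" for n
    proof (intro integral_cong_AE)
      show "AE \<omega> in M. f (1 / sqrt n * centred_sum (\<lambda>n \<omega>. k) n \<omega>) = f 0"
        using \<open>AE \<omega> in M. centred_sum (\<lambda>n \<omega>. k) n \<omega> = 0\<close> by eventually_elim simp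
    qed (simp_all add: centred_sum_const)
    then show ?thesis using True by (simp add: centred_normal_def integral_return prob_space)
  next
    case False
    define \<sigma> where "\<sigma> = sqrt (var k)"
    have \<sigma>: "\<sigma> > 0" "\<sigma>\<^sup>2 = var k" using False var_nonneg[OF k] by (auto simp: \<sigma>_def)
    have mY: "(\<integral>\<omega>. Y k (Suc n) \<omega> \<partial>M) = mean k" for n
      using integral_copy[OF k, of "Suc n" "\<lambda>x. x"] by (simp add: arm_mean_def)
    have clt: "weak_conv_m (\<lambda>n. distr M borel (\<lambda>x. (\<Sum>i<n. Y k (Suc i) x - mean k) / sqrt (n * \<sigma>\<^sup>2))) std_normal_distribution"
    proof (rule central_limit_theorem[where \<mu> = "distr M borel (X k)"])
      show "integrable M (\<lambda>x. (Y k (Suc n) x)\<^sup>2)" for n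
        using integrable_copy[OF k, of "Suc n" "\<lambda>x. x\<^sup>2"] integrable_payoff_square[OF k] by simp
      show "variance (Y k (Suc n)) = \<sigma>\<^sup>2" for n
        using sq(2)[of n] by (simp add: mY \<sigma>)
    qed (use indep_vars_arm[OF k] mY \<sigma> distr_copy[OF k] in auto)
    have "(\<lambda>n. \<integral>z. f (\<sigma> * z) \<partial>distr M borel (\<lambda>x. (\<Sum>i<n. Y k (Suc i) x - mean k) / sqrt (n * \<sigma>\<^sup>2)))
        \<longlonglongrightarrow> (\<integral>z. f (\<sigma> * z) \<partial>std_normal_distribution)"
    proof (rule weak_conv_imp_integral_bdd_continuous_conv[OF _ real_dist_normal_dist clt])
      show "real_distribution (distr M borel (\<lambda>x. (\<Sum>i<n. Y k (Suc i) x - mean k) / sqrt (n * \<sigma>\<^sup>2)))" for n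
        by (rule real_distribution_distr) measurable
      show "isCont (\<lambda>z. f (\<sigma> * z)) x" for x
        by (rule continuous_on_interior[of UNIV])
          (auto intro!: continuous_on_compose2[OF f(1)] continuous_intros)
    qed (use f(2) in auto)
    moreover have "(\<integral>z. f (\<sigma> * z) \<partial>distr M borel (\<lambda>x. (\<Sum>i<n. Y k (Suc i) x - mean k) / sqrt (n * \<sigma>\<^sup>2)))
        = (\<integral>\<omega>. f (1 / sqrt n * centred_sum (\<lambda>n \<omega>. k) n \<omega>) \<partial>M)" for n
      using \<sigma>(1) by (subst integral_distr) (auto simp: centred_sum_const real_sqrt_mult)
    ultimately show ?thesis
      using integral_centred_normal_scale[OF \<sigma>(1), of f] by (simp add: \<sigma>(2))
  qed
qed

end

text \<open>The number \<open>q\<close> is half the order of the controlled moment; it will be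
  \<open>max g 2 / 2\<close>.\<close>

locale bandit_moments = bandit +
  fixes q :: real
  assumes q: "q \<ge> 1"
    and moments: "\<And>k. k \<in> {1..K} \<Longrightarrow> integrable M (\<lambda>\<omega>. (1 + (X k \<omega> - mean k)\<^sup>2) powr q)"
begin

definition normalized_sum :: "(nat \<Rightarrow> 'a \<Rightarrow> nat) \<Rightarrow> nat \<Rightarrow> 'a \<Rightarrow> real" where
  "normalized_sum t n \<omega> = 1 / sqrt n * centred_sum t n \<omega>"

text \<open>Growth of order \<open>2 * q - 1\<close> in \<open>\<bar>w\<bar>\<close>, one order
  below the controlled moment.\<close>

definition growth :: "(real \<Rightarrow> real) \<Rightarrow> real \<Rightarrow> bool" where
  "growth f C \<longleftrightarrow> (\<forall>w. \<bar>f w\<bar> \<le> C * (1 + w\<^sup>2) powr (q - 1/2))"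

lemma growth_mono: "growth f C \<Longrightarrow> C \<le> C' \<Longrightarrow> growth f C'"
  unfolding growth_def by (meson mult_right_mono order_trans powr_ge_zero)

lemma growth_nonneg: "growth f C \<Longrightarrow> C \<ge> 0"
  unfolding growth_def by (drule spec[of _ 0]) simp

lemma measurable_normalized_sum [measurable]:
  "predictable t \<Longrightarrow> normalized_sum t n \<in> borel_measurable M"
  unfolding normalized_sum_def[abs_def] using measurable_centred_sum_M by simp

section \<open>Estimates uniform over strategies and horizons\<close>

lemma normalized_sum_moments:
  obtains A where "A \<ge> 0"
    "\<And>t n. predictable t \<Longrightarrow> n \<ge> 1 \<Longrightarrow> integrable M (\<lambda>\<omega>. (1 + (normalized_sum t n \<omega>)\<^sup>2) powr q)"
    "\<And>t n. predictable t \<Longrightarrow> n \<ge> 1 \<Longrightarrow> (\<integral>\<omega>. (1 + (normalized_sum t n \<omega>)\<^sup>2) powr q \<partial>M) \<le> A"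
proof -
  obtain A where
    "\<And>t n. predictable t \<Longrightarrow> n \<ge> 1 \<Longrightarrow> integrable M (\<lambda>\<omega>. (1 + (normalized_sum t n \<omega>)\<^sup>2) powr q)"
    "\<And>t n. predictable t \<Longrightarrow> n \<ge> 1 \<Longrightarrow> (\<integral>\<omega>. (1 + (normalized_sum t n \<omega>)\<^sup>2) powr q \<partial>M) \<le> A"
    using centred_sum_moments_bounded[OF q moments] unfolding normalized_sum_def by metis
  then show ?thesis using that[of "max A 0"] by (metis max.cobounded2 max.coboundedI1)
qed

lemma integrable_normalized_sum:
  assumes "predictable t" "n \<ge> 1" "f \<in> borel_measurable borel" "growth f C"
  shows "integrable M (\<lambda>\<omega>. f (normalized_sum t n \<omega>))"
proof -
  obtain A where "integrable M (\<lambda>\<omega>. (1 + (normalized_sum t n \<omega>)\<^sup>2) powr q)"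
    using normalized_sum_moments assms(1,2) by metis
  then show ?thesis
    using assms(4) unfolding growth_def
    by (intro integrable_growth[OF measurable_normalized_sum[OF assms(1)] assms(3)]) auto
qed

text \<open>The order of quantifiers is the point: \<open>R\<close> depends on \<open>C\<close> and
  \<open>\<epsilon>\<close> only. The two functions may therefore be built from \<open>R\<close>, as
  in the concave comparison, or vary with \<open>n\<close>, as in the removal of the drift.\<close>

lemma uniformly_close:
  assumes "C \<ge> 0" "\<epsilon> > 0"
  obtains R where "R > 0"
    "\<And>t n f1 f2. \<lbrakk>predictable t; n \<ge> 1; f1 \<in> borel_measurable borel; f2 \<in> borel_measurable borel;
        growth f1 C; growth f2 C; \<And>w. \<bar>w\<bar> \<le> R \<Longrightarrow> \<bar>f1 w - f2 w\<bar> \<le> \<epsilon> / 2\<rbrakk>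
      \<Longrightarrow> \<bar>(\<integral>\<omega>. f1 (normalized_sum t n \<omega>) \<partial>M) - (\<integral>\<omega>. f2 (normalized_sum t n \<omega>) \<partial>M)\<bar> \<le> \<epsilon>"
proof -
  obtain A where A: "A \<ge> 0"
    "\<And>t n. predictable t \<Longrightarrow> n \<ge> 1 \<Longrightarrow> integrable M (\<lambda>\<omega>. (1 + (normalized_sum t n \<omega>)\<^sup>2) powr q)"
    "\<And>t n. predictable t \<Longrightarrow> n \<ge> 1 \<Longrightarrow> (\<integral>\<omega>. (1 + (normalized_sum t n \<omega>)\<^sup>2) powr q \<partial>M) \<le> A"
    using normalized_sum_moments by blast
  \<comment> \<open>Makes the tail term \<open>2 * C * A / R\<close> at most
    \<open>\<epsilon> / 2\<close>; the summand 1 keeps \<open>R\<close> positive when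
    \<open>C * A = 0\<close>.\<close>
  define R where "R = (4 * C * A + 1) / \<epsilon>"
  have "4 * C * A + 1 > 0" using A(1) assms(1) by (simp add: add_nonneg_pos)
  then have R: "R > 0" and "2 * C * A / R \<le> \<epsilon> / 2"
    using assms(2) by (auto simp: R_def field_simps)
  show thesis
  proof (rule that[OF R])
    fix t :: "nat \<Rightarrow> 'a \<Rightarrow> nat" and n :: nat and f1 f2 :: "real \<Rightarrow> real"
    assume t: "predictable t" "n \<ge> 1" and f: "f1 \<in> borel_measurable borel" "f2 \<in> borel_measurable borel"
      and g: "growth f1 C" "growth f2 C" and close: "\<And>w. \<bar>w\<bar> \<le> R \<Longrightarrow> \<bar>f1 w - f2 w\<bar> \<le> \<epsilon> / 2"
    have "\<bar>(\<integral>\<omega>. f1 (normalized_sum t n \<omega>) \<partial>M) - (\<integral>\<omega>. f2 (normalized_sum t n \<omega>) \<partial>M)\<bar> \<le> \<epsilon> / 2 + 2 * C * A / R"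
      by (rule expectation_close[OF measurable_normalized_sum[OF t(1)] f A(2,3)[OF t] _ _ R close])
        (use g in \<open>auto simp: growth_def\<close>)
    then show "\<bar>(\<integral>\<omega>. f1 (normalized_sum t n \<omega>) \<partial>M) - (\<integral>\<omega>. f2 (normalized_sum t n \<omega>) \<partial>M)\<bar> \<le> \<epsilon>"
      using \<open>2 * C * A / R \<le> \<epsilon> / 2\<close> by simp
  qed
qed

text \<open>Extends the limit from bounded to growing test functions by truncation. Three errors of
  size \<open>r / 4\<close> are added: truncation under the sums, convergence for the truncated
  function, truncation under the normal law.\<close>

lemma clt_growth:
  assumes k: "k \<in> {1..K}" and f: "continuous_on UNIV f" "growth f C"
  shows "(\<lambda>n. \<integral>\<omega>. f (normalized_sum (\<lambda>n \<omega>. k) n \<omega>) \<partial>M) \<longlonglongrightarrow> (\<integral>y. f y \<partial>centred_normal (var k))"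
proof (rule LIMSEQ_I)
  fix r :: real assume "r > 0"
  define \<epsilon> where "\<epsilon> = r / 4"
  have \<epsilon>: "\<epsilon> > 0" using \<open>r > 0\<close> by (simp add: \<epsilon>_def)
  have C: "C \<ge> 0" by (rule growth_nonneg[OF f(2)])
  have fm: "f \<in> borel_measurable borel" using f(1) by (rule borel_measurable_continuous_onI)
  let ?N = "centred_normal (var k)"
  interpret N: prob_space ?N by (rule prob_space_centred_normal[OF var_nonneg[OF k]])
  define A where "A = (\<integral>y. (1 + y\<^sup>2) powr q \<partial>?N)"
  have A: "A \<ge> 0" unfolding A_def by (intro integral_nonneg_AE) auto
  have int: "integrable ?N (\<lambda>y. (1 + y\<^sup>2) powr q)"
    using q by (intro integrable_centred_normal_powr var_nonneg[OF k]) simp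
  obtain R0 where R0: "R0 > 0"
    "\<And>t n f1 f2. \<lbrakk>predictable t; n \<ge> 1; f1 \<in> borel_measurable borel; f2 \<in> borel_measurable borel;
        growth f1 C; growth f2 C; \<And>w. \<bar>w\<bar> \<le> R0 \<Longrightarrow> \<bar>f1 w - f2 w\<bar> \<le> \<epsilon> / 2\<rbrakk>
      \<Longrightarrow> \<bar>(\<integral>\<omega>. f1 (normalized_sum t n \<omega>) \<partial>M) - (\<integral>\<omega>. f2 (normalized_sum t n \<omega>) \<partial>M)\<bar> \<le> \<epsilon>"
    using uniformly_close[OF C \<epsilon>] by blast
  \<comment> \<open>Large enough for both truncations: \<open>R0\<close> handles the sums, the other
    term the normal law, whose moment \<open>A\<close> is a separate constant.\<close>
  define R where "R = max R0 ((2 * C * A + 1) / \<epsilon>)"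
  have "(2 * C * A + 1) / \<epsilon> > 0" using A C \<epsilon> by (simp add: add_nonneg_pos)
  then have R: "R > 0" "R \<ge> R0" and "2 * C * A + 1 \<le> R * \<epsilon>"
    using R0(1) \<epsilon> by (auto simp: R_def max_def field_simps)
  then have tail: "2 * C * A / R \<le> \<epsilon>" by (simp add: field_simps)
  \<comment> \<open>Clamping the argument keeps continuity, makes \<open>h\<close> bounded, and only
    shrinks \<open>\<bar>w\<bar>\<close>, so the growth bound of \<open>f\<close> carries over with
    the same constant.\<close>
  define h where "h w = f (max (- R) (min R w))" for w
  have h_cont: "continuous_on UNIV h"
    unfolding h_def[abs_def] by (intro continuous_on_compose2[OF f(1)] continuous_intros) auto
  then have hm: "h \<in> borel_measurable borel" by (rule borel_measurable_continuous_onI)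
  have h_eq: "h w = f w" if "\<bar>w\<bar> \<le> R" for w using that by (auto simp: h_def abs_le_iff max_def min_def)
  have h_growth: "growth h C"
    unfolding growth_def
  proof
    fix w :: real
    have "\<bar>max (- R) (min R w)\<bar> \<le> \<bar>w\<bar>" using R by (auto simp: max_def min_def)
    then have "(max (- R) (min R w))\<^sup>2 \<le> w\<^sup>2" by (rule abs_le_square_iff[THEN iffD1])
    then have "C * (1 + (max (- R) (min R w))\<^sup>2) powr (q - 1/2) \<le> C * (1 + w\<^sup>2) powr (q - 1/2)"
      using C q by (intro mult_left_mono powr_mono2) auto
    then show "\<bar>h w\<bar> \<le> C * (1 + w\<^sup>2) powr (q - 1/2)"
      using f(2) unfolding growth_def h_def by (meson order_trans)
  qed
  have "compact (f ` {-R..R})"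
    by (intro compact_continuous_image continuous_on_subset[OF f(1)]) auto
  then have "bounded (f ` {-R..R})" by (rule compact_imp_bounded)
  then obtain B where "\<forall>w\<in>{-R..R}. \<bar>f w\<bar> \<le> B"
    by (auto simp: bounded_iff)
  then have B: "\<bar>f w\<bar> \<le> B" if "w \<in> {-R..R}" for w
    using that by blast
  have "\<bar>h w\<bar> \<le> B" for w unfolding h_def using R by (intro B) auto
  from clt_bounded[OF k h_cont this]
  have "(\<lambda>n. \<integral>\<omega>. h (normalized_sum (\<lambda>n \<omega>. k) n \<omega>) \<partial>M) \<longlonglongrightarrow> (\<integral>y. h y \<partial>?N)"
    by (simp add: normalized_sum_def)
  from LIMSEQ_D[OF this \<epsilon>] obtain n0 where n0:
    "\<And>n. n \<ge> n0 \<Longrightarrow> \<bar>(\<integral>\<omega>. h (normalized_sum (\<lambda>n \<omega>. k) n \<omega>) \<partial>M) - (\<integral>y. h y \<partial>?N)\<bar> < \<epsilon>"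
    by auto
  have "\<bar>(\<integral>y. f y \<partial>?N) - (\<integral>y. h y \<partial>?N)\<bar> \<le> 0 + 2 * C * A / R"
    by (rule N.expectation_close[of "\<lambda>y. y", OF _ fm hm int _ _ _ R(1)])
      (use f(2) h_growth h_eq in \<open>auto simp: A_def growth_def measurable_def\<close>)
  then have N_close: "\<bar>(\<integral>y. f y \<partial>?N) - (\<integral>y. h y \<partial>?N)\<bar> \<le> \<epsilon>" using tail by simp
  show "\<exists>no. \<forall>n\<ge>no. norm ((\<integral>\<omega>. f (normalized_sum (\<lambda>n \<omega>. k) n \<omega>) \<partial>M) - (\<integral>y. f y \<partial>?N)) < r"
  proof (intro exI[of _ "max n0 1"] allI impI)
    fix n assume n: "max n0 1 \<le> n"
    have "\<bar>(\<integral>\<omega>. f (normalized_sum (\<lambda>n \<omega>. k) n \<omega>) \<partial>M) - (\<integral>\<omega>. h (normalized_sum (\<lambda>n \<omega>. k) n \<omega>) \<partial>M)\<bar> \<le> \<epsilon>"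
      using n R \<epsilon> h_eq by (intro R0(2) predictable_const k fm hm f(2) h_growth) auto
    then show "norm ((\<integral>\<omega>. f (normalized_sum (\<lambda>n \<omega>. k) n \<omega>) \<partial>M) - (\<integral>y. f y \<partial>?N)) < r"
      using n0[of n] n N_close \<open>r > 0\<close> unfolding \<epsilon>_def abs_le_iff abs_less_iff real_norm_def by linarith
  qed
qed

text \<open>The two-sided clause treats strategies that switch between arms of equal variance. Their
  payoffs need not be identically distributed, so the central limit theorem is not applied to them
  directly but reached through the exchange with a single arm.\<close>

lemma concave_comparison:
  assumes k: "k \<in> {1..K}" and f: "concave_on UNIV f" "growth f C" and "\<epsilon> > 0"
  shows "\<exists>n0\<ge>1. \<forall>n\<ge>n0. \<forall>t. predictable t \<longrightarrow>
      ((\<forall>j\<in>{1..K}. var k \<le> var j) \<longrightarrow>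
        (\<integral>\<omega>. f (normalized_sum t n \<omega>) \<partial>M) \<le> (\<integral>\<omega>. f (normalized_sum (\<lambda>n \<omega>. k) n \<omega>) \<partial>M) + \<epsilon>) \<and>
      ((\<forall>j\<ge>1. \<forall>\<omega>\<in>space M. var (t j \<omega>) = var k) \<longrightarrow>
        \<bar>(\<integral>\<omega>. f (normalized_sum t n \<omega>) \<partial>M) - (\<integral>\<omega>. f (normalized_sum (\<lambda>n \<omega>. k) n \<omega>) \<partial>M)\<bar> \<le> \<epsilon>)"
proof -
  obtain s where s: "\<And>R. R > 0 \<Longrightarrow> \<exists>g L. concave_on UNIV g \<and> (\<forall>x y. \<bar>g x - g y\<bar> \<le> L * \<bar>x - y\<bar>) \<and>
      (\<forall>y. \<bar>y\<bar> \<le> R \<longrightarrow> g y = f y) \<and> (\<forall>y. f y \<le> g y) \<and> (\<forall>y. g y \<le> f 0 + s * y)"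
    using concave_lipschitz_majorant[OF f(1)] by blast
  \<comment> \<open>Fixed before \<open>R\<close> is known: any majorant lies between
    \<open>f\<close> and the tangent at 0, which does not involve \<open>R\<close>, and the summand
    1 leaves room for the smoothing error.\<close>
  define C' where "C' = C + \<bar>f 0\<bar> + \<bar>s\<bar> + 1"
  have "\<bar>f 0\<bar> \<le> C" using f(2) unfolding growth_def by (auto dest: spec[of _ 0])
  then have C': "C' \<ge> 0" "C \<le> C'" by (auto simp: C'_def)
  define \<epsilon>' where "\<epsilon>' = \<epsilon> / 4"
  have \<epsilon>': "\<epsilon>' > 0" using \<open>\<epsilon> > 0\<close> by (simp add: \<epsilon>'_def)
  obtain R where R: "R > 0"
    "\<And>t n f1 f2. \<lbrakk>predictable t; n \<ge> 1; f1 \<in> borel_measurable borel; f2 \<in> borel_measurable borel;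
        growth f1 C'; growth f2 C'; \<And>w. \<bar>w\<bar> \<le> R \<Longrightarrow> \<bar>f1 w - f2 w\<bar> \<le> \<epsilon>' / 2\<rbrakk>
      \<Longrightarrow> \<bar>(\<integral>\<omega>. f1 (normalized_sum t n \<omega>) \<partial>M) - (\<integral>\<omega>. f2 (normalized_sum t n \<omega>) \<partial>M)\<bar> \<le> \<epsilon>'"
    using uniformly_close[OF C'(1) \<epsilon>'] by blast
  obtain \<psi> L where \<psi>: "concave_on UNIV \<psi>" "\<And>x y. \<bar>\<psi> x - \<psi> y\<bar> \<le> L * \<bar>x - y\<bar>"
    "\<And>y. \<bar>y\<bar> \<le> R \<Longrightarrow> \<psi> y = f y" "\<And>y. f y \<le> \<psi> y" "\<And>y. \<psi> y \<le> f 0 + s * y"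
    using s[OF R(1)] by blast
  have L: "L \<ge> 0" using \<psi>(2)[of 0 1] by simp
  \<comment> \<open>The smoothing error \<open>2 * \<delta> * L\<close> must be at most 1 for the
    growth bound and at most \<open>\<epsilon>' / 2\<close> for closeness on the interval;
    \<open>L + 1\<close> avoids a division by 0.\<close>
  define \<delta> where "\<delta> = min 1 (\<epsilon>' / 2) / (2 * (L + 1))"
  have \<delta>: "\<delta> > 0" using \<epsilon>' L by (simp add: \<delta>_def)
  have "2 * \<delta> * L \<le> 2 * \<delta> * (L + 1)" using \<delta> by (intro mult_left_mono) auto
  also have "2 * \<delta> * (L + 1) = \<delta> * (2 * (L + 1))" by simp
  also have "\<dots> = min 1 (\<epsilon>' / 2)" unfolding \<delta>_def using L by (intro nonzero_eq_divide_eq[THEN iffD1] refl) simp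
  finally have \<delta>L: "2 * \<delta> * L \<le> 1" "2 * \<delta> * L \<le> \<epsilon>' / 2" by auto
  obtain g g1 g2 B where g: "\<And>x. (g has_real_derivative g1 x) (at x)"
    "\<And>x. (g1 has_real_derivative g2 x) (at x)" "\<And>x. \<bar>g1 x\<bar> \<le> L" "\<And>x. \<bar>g2 x\<bar> \<le> B"
    "\<And>x y. \<bar>g2 x - g2 y\<bar> \<le> B * \<bar>x - y\<bar>" "\<And>x. g2 x \<le> 0" "\<And>x. \<bar>g x - \<psi> x\<bar> \<le> 2 * \<delta> * L"
    using lipschitz_concave_smoothing[OF \<psi>(2,1) \<delta>] by metis
  have gm: "g \<in> borel_measurable borel"
    using g(1) by (intro borel_measurable_continuous_onI continuous_at_imp_continuous_on) (auto intro: DERIV_isCont)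
  have "convex_on UNIV (\<lambda>x. - f x)" using f(1) by (simp add: concave_on_def)
  then have "continuous_on UNIV (\<lambda>x. - f x)" by (rule convex_on_continuous[OF open_UNIV])
  then have "continuous_on UNIV (\<lambda>x. - (- f x))" by (rule continuous_on_minus)
  then have fm: "f \<in> borel_measurable borel" by (intro borel_measurable_continuous_onI) simp
  have gg: "growth g C'"
    unfolding growth_def
  proof
    fix w :: real
    let ?H = "(1 + w\<^sup>2) powr (q - 1/2)"
    have H: "1 \<le> ?H" "\<bar>w\<bar> \<le> ?H" using q by (auto intro: one_plus_square_powr_ge_1 abs_le_one_plus_square_powr)
    have "\<bar>f w\<bar> \<le> C * ?H" using f(2) by (simp add: growth_def)
    moreover have "\<bar>f 0\<bar> * 1 \<le> \<bar>f 0\<bar> * ?H" using H by (intro mult_left_mono) auto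
    moreover have "\<bar>s * w\<bar> \<le> \<bar>s\<bar> * ?H" unfolding abs_mult using H by (intro mult_left_mono) auto
    moreover have "\<bar>g w - \<psi> w\<bar> \<le> 1 * ?H" using g(7)[of w] \<delta>L H by simp
    moreover have "0 \<le> C * ?H" using \<open>\<bar>f w\<bar> \<le> C * ?H\<close> by linarith
    moreover have "C' * ?H = C * ?H + \<bar>f 0\<bar> * ?H + \<bar>s\<bar> * ?H + 1 * ?H" by (simp add: C'_def algebra_simps)
    ultimately show "\<bar>g w\<bar> \<le> C' * ?H" using \<psi>(4)[of w] \<psi>(5)[of w] by linarith
  qed
  have close: "\<bar>(\<integral>\<omega>. f (normalized_sum t n \<omega>) \<partial>M) - (\<integral>\<omega>. g (normalized_sum t n \<omega>) \<partial>M)\<bar> \<le> \<epsilon>'"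
    if "predictable t" "n \<ge> 1" for t n
  proof (rule R(2)[OF that fm gm growth_mono[OF f(2) C'(2)] gg])
    fix w :: real assume "\<bar>w\<bar> \<le> R"
    then show "\<bar>f w - g w\<bar> \<le> \<epsilon>' / 2" using g(7)[of w] \<delta>L \<psi>(3)[of w] by (simp add: abs_minus_commute)
  qed
  have "(\<lambda>n. 2 * B * truncated_second_moment (1 / sqrt (real n))) \<longlonglongrightarrow> 2 * B * 0"
    by (intro tendsto_mult_left truncated_second_moment_tendsto_0)
  then have "(\<lambda>n. 2 * B * truncated_second_moment (1 / sqrt (real n))) \<longlonglongrightarrow> 0" by simp
  from LIMSEQ_D[OF this \<epsilon>'] obtain n1 where n1:
    "\<And>n. n \<ge> n1 \<Longrightarrow> 2 * B * truncated_second_moment (1 / sqrt (real n)) \<le> \<epsilon>'" by fastforce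
  show ?thesis
  proof (intro exI[of _ "max n1 1"] conjI allI impI)
    fix n :: nat and t :: "nat \<Rightarrow> 'a \<Rightarrow> nat" assume n: "max n1 1 \<le> n" and t: "predictable t"
    let ?E = "\<lambda>f t. \<integral>\<omega>. f (normalized_sum t n \<omega>) \<partial>M"
    have c: "0 \<le> 1 / sqrt (real n)" by simp
    \<comment> \<open>The square of \<open>1 / sqrt n\<close> cancels the number of exchanges,
      leaving \<open>2 * B\<close> times the truncated second moment.\<close>
    have e: "real n * (2 * (1 / sqrt (real n))\<^sup>2 * B * truncated_second_moment (1 / sqrt (real n))) \<le> \<epsilon>'"
      using n1[of n] n by (simp add: power_divide)
    have cl: "\<bar>?E f t - ?E g t\<bar> \<le> \<epsilon>'" "\<bar>?E f (\<lambda>n \<omega>. k) - ?E g (\<lambda>n \<omega>. k)\<bar> \<le> \<epsilon>'"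
      using close[OF t, of n] close[OF predictable_const[OF k], of n] n by auto
    note ex = lindeberg_exchange[OF g(1-5) t k c, where n = n, folded normalized_sum_def]
    show "?E f t \<le> ?E f (\<lambda>n \<omega>. k) + \<epsilon>" if "\<forall>j\<in>{1..K}. var k \<le> var j"
    proof -
      have "?E g t - ?E g (\<lambda>n \<omega>. k) \<le> \<epsilon>'"
        using ex(1)[OF g(6)] that e by fastforce
      then show ?thesis using cl \<open>\<epsilon> > 0\<close> unfolding \<epsilon>'_def abs_le_iff by linarith
    qed
    show "\<bar>?E f t - ?E f (\<lambda>n \<omega>. k)\<bar> \<le> \<epsilon>" if "\<forall>j\<ge>1. \<forall>\<omega>\<in>space M. var (t j \<omega>) = var k"
    proof -
      have "\<bar>?E g t - ?E g (\<lambda>n \<omega>. k)\<bar> \<le> \<epsilon>'"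
        using ex(2) that e by fastforce
      then show ?thesis using cl \<open>\<epsilon> > 0\<close> unfolding \<epsilon>'_def abs_le_iff by linarith
    qed
  qed simp
qed

text \<open>For \<open>\<bar>w\<bar> \<le> R\<close> the shift is at most \<open>R / sqrt n\<close>,
  so uniform continuity on a compact rectangle applies. Elsewhere growth in \<open>w\<close>
  suffices: since \<open>sqrt n \<ge> 1\<close>, the shifted points stay in the region
  \<open>\<bar>x\<bar> \<le> m + \<bar>y\<bar>\<close>, where \<open>u\<close> is controlled by its
  second argument.\<close>

lemma drift_negligible:
  fixes u :: "real \<times> real \<Rightarrow> real"
  assumes u: "continuous_on UNIV u"
    and grow: "\<And>x y. \<bar>x\<bar> \<le> m + \<bar>y\<bar> \<Longrightarrow> \<bar>u (x, y)\<bar> \<le> C * (1 + y\<^sup>2) powr (q - 1/2)"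
    and a: "\<bar>a\<bar> \<le> m" and "\<epsilon> > 0"
  shows "\<exists>n0\<ge>1. \<forall>n\<ge>n0. \<forall>t. predictable t \<longrightarrow>
    \<bar>(\<integral>\<omega>. u (a + normalized_sum t n \<omega> / sqrt n, normalized_sum t n \<omega>) \<partial>M)
      - (\<integral>\<omega>. u (a, normalized_sum t n \<omega>) \<partial>M)\<bar> \<le> \<epsilon>"
proof -
  have C: "C \<ge> 0" using grow[of 0 0] a by fastforce
  obtain R where R: "R > 0"
    "\<And>t n f1 f2. \<lbrakk>predictable t; n \<ge> 1; f1 \<in> borel_measurable borel; f2 \<in> borel_measurable borel;
        growth f1 C; growth f2 C; \<And>w. \<bar>w\<bar> \<le> R \<Longrightarrow> \<bar>f1 w - f2 w\<bar> \<le> \<epsilon> / 2\<rbrakk>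
      \<Longrightarrow> \<bar>(\<integral>\<omega>. f1 (normalized_sum t n \<omega>) \<partial>M) - (\<integral>\<omega>. f2 (normalized_sum t n \<omega>) \<partial>M)\<bar> \<le> \<epsilon>"
    using uniformly_close[OF C \<open>\<epsilon> > 0\<close>] by blast
  have "compact ({a - R..a + R} \<times> {-R..R})" by (intro compact_Times) auto
  then have "uniformly_continuous_on ({a - R..a + R} \<times> {-R..R}) u"
    by (intro compact_uniformly_continuous continuous_on_subset[OF u]) auto
  then obtain d where d: "d > 0" "\<And>p p'. \<lbrakk>p \<in> {a - R..a + R} \<times> {-R..R}; p' \<in> {a - R..a + R} \<times> {-R..R}; dist p' p < d\<rbrakk>
      \<Longrightarrow> dist (u p') (u p) < \<epsilon> / 2"
    using \<open>\<epsilon> > 0\<close> unfolding uniformly_continuous_on_def by (metis half_gt_zero)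
  have "(\<lambda>n. R / sqrt (real n)) \<longlonglongrightarrow> 0"
    by (rule real_tendsto_divide_at_top[OF tendsto_const])
      (rule filterlim_compose[OF sqrt_at_top filterlim_real_sequentially])
  from LIMSEQ_D[OF this d(1)] obtain n1 where n1: "\<And>n. n \<ge> n1 \<Longrightarrow> R / sqrt (real n) < d"
    using R(1) by auto
  show ?thesis
  proof (intro exI[of _ "max n1 1"] conjI allI impI)
    fix n :: nat and t :: "nat \<Rightarrow> 'a \<Rightarrow> nat" assume n: "max n1 1 \<le> n" and t: "predictable t"
    have sq: "1 \<le> sqrt n" using n by simp
    have le: "\<bar>w / sqrt n\<bar> \<le> \<bar>w\<bar>" for w
      using sq by (simp add: divide_le_eq mult_le_cancel_left1)
    show "\<bar>(\<integral>\<omega>. u (a + normalized_sum t n \<omega> / sqrt n, normalized_sum t n \<omega>) \<partial>M)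
      - (\<integral>\<omega>. u (a, normalized_sum t n \<omega>) \<partial>M)\<bar> \<le> \<epsilon>"
    proof (rule R(2)[OF t, of n "\<lambda>w. u (a + w / sqrt n, w)" "\<lambda>w. u (a, w)"])
      show "(\<lambda>w. u (a + w / sqrt n, w)) \<in> borel_measurable borel" "(\<lambda>w. u (a, w)) \<in> borel_measurable borel"
        using sq by (auto intro!: borel_measurable_continuous_onI continuous_on_compose2[OF u] continuous_intros)
      show "growth (\<lambda>w. u (a + w / sqrt n, w)) C"
        unfolding growth_def
      proof
        fix w show "\<bar>u (a + w / sqrt n, w)\<bar> \<le> C * (1 + w\<^sup>2) powr (q - 1/2)"
          using le[of w] a by (intro grow) linarith
      qed
      show "growth (\<lambda>w. u (a, w)) C" unfolding growth_def using a by (intro allI grow) auto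
      fix w :: real assume w: "\<bar>w\<bar> \<le> R"
      have wR: "- R \<le> w / sqrt n" "w / sqrt n \<le> R"
        using order_trans[OF le w] unfolding abs_le_iff by linarith+
      have "\<bar>w / sqrt n\<bar> \<le> R / sqrt n" using w by (simp add: divide_right_mono)
      then have "dist (a + w / sqrt n, w) (a, w) < d"
        using n1[of n] n by (simp add: dist_prod_def dist_real_def)
      then have "dist (u (a + w / sqrt n, w)) (u (a, w)) < \<epsilon> / 2"
        using w wR R(1) by (intro d(2)) (auto simp: abs_le_iff)
      then show "\<bar>u (a + w / sqrt n, w) - u (a, w)\<bar> \<le> \<epsilon> / 2" by (simp add: dist_real_def)
    qed (use n in auto)
  qed simp
qed

end

subsection \<open>Expected utility\<close>

context bandit
begin

text \<open>For \<open>g \<le> 2\<close> the finite variance supplies the order 2; for larger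
  \<open>g\<close> the \<open>g\<close>-th moment survives centring.\<close>

lemma centred_moments:
  assumes k: "k \<in> {1..K}" and g: "integrable M (\<lambda>\<omega>. \<bar>X k \<omega>\<bar> powr g)"
  shows "integrable M (\<lambda>\<omega>. (1 + (X k \<omega> - mean k)\<^sup>2) powr (max g 2 / 2))"
proof (cases "g \<le> 2")
  case True
  then show ?thesis
    using integrable_centred_square[OF k] by (simp add: max_def add_nonneg_nonneg)
next
  case False
  let ?m = "1 + \<bar>mean k\<bar>"
  have [measurable]: "X k \<in> borel_measurable M" by (rule measurable_payoff[OF k])
  have le: "(1 + (x - mean k)\<^sup>2) powr (max g 2 / 2) \<le> 2 powr g * (?m powr g + \<bar>x\<bar> powr g)" for x
  proof -
    have "\<bar>x - mean k\<bar>\<^sup>2 \<le> (\<bar>x\<bar> + \<bar>mean k\<bar>)\<^sup>2" by (intro power_mono) auto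
    then have "1 + (x - mean k)\<^sup>2 \<le> (?m + \<bar>x\<bar>)\<^sup>2" by (simp add: power2_eq_square algebra_simps)
    then have "(1 + (x - mean k)\<^sup>2) powr (g / 2) \<le> ((?m + \<bar>x\<bar>)\<^sup>2) powr (g / 2)"
      using False by (intro powr_mono2) auto
    also have "\<dots> = (?m + \<bar>x\<bar>) powr g"
      by (simp add: powr_powr add_pos_nonneg flip: powr_numeral)
    also have "\<dots> \<le> (2 * max ?m \<bar>x\<bar>) powr g"
    proof (rule powr_mono2)
      show "?m + \<bar>x\<bar> \<le> 2 * max ?m \<bar>x\<bar>"
        using max.cobounded1[of ?m "\<bar>x\<bar>"] max.cobounded2[of "\<bar>x\<bar>" ?m] by linarith
    qed (use False in auto)
    also have "\<dots> = 2 powr g * max ?m \<bar>x\<bar> powr g" by (intro powr_mult)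
    also have "\<dots> \<le> 2 powr g * (?m powr g + \<bar>x\<bar> powr g)"
      by (intro mult_left_mono) (auto simp: max_def)
    finally show ?thesis using False by (simp add: max_def)
  qed
  have "integrable M (\<lambda>\<omega>. 2 powr g * (?m powr g + \<bar>X k \<omega>\<bar> powr g))" using g by simp
  then show ?thesis
  proof (rule Bochner_Integration.integrable_bound)
    show "AE \<omega> in M. norm ((1 + (X k \<omega> - mean k)\<^sup>2) powr (max g 2 / 2))
        \<le> norm (2 powr g * (?m powr g + \<bar>X k \<omega>\<bar> powr g))"
      by (intro AE_I2) (use le in simp)
  qed measurable
qed

lemma reward_measurable:
  assumes "predictable t" "i \<ge> 1"
  shows "reward Y t i \<in> borel_measurable M"
proof (rule measurable_stage_algebra_imp)
  show "reward Y t i \<in> borel_measurable (stage_algebra {1..i})"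
    unfolding reward_def[abs_def]
    by (rule measurable_chosen_copy[where h = "\<lambda>k x. x", OF predictableD[OF assms]]) (use assms(2) in auto)
qed auto

lemma chosen_mean_measurable:
  assumes "predictable t" "i \<ge> 1"
  shows "(\<lambda>\<omega>. mean (t i \<omega>)) \<in> borel_measurable M"
proof (rule measurable_stage_algebra_imp)
  show "(\<lambda>\<omega>. mean (t i \<omega>)) \<in> borel_measurable (stage_algebra {1..<i})"
    using measurable_compose[OF predictableD[OF assms order_refl], of mean borel] by simp
qed auto

end

text \<open>In this region the norm is at most linear in \<open>\<bar>y\<bar>\<close>, so a bound in
  both variables becomes one in \<open>y\<close> alone. The arguments of \<open>u\<close> lie there
  because the first is a bounded mean plus the second divided by \<open>sqrt n\<close>.\<close>

lemma growth_bound_near_axis: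
  fixes u :: "real \<times> real \<Rightarrow> real"
  assumes g: "g \<ge> 1" and c: "c > 0" "\<And>x y. \<bar>u (x, y)\<bar> \<le> c * (1 + norm (x, y) powr (g - 1))"
    and m: "m \<ge> 0" and x: "\<bar>x\<bar> \<le> m + \<bar>y\<bar>"
  shows "\<bar>u (x, y)\<bar> \<le> c * (1 + (m + 3) powr (max g 2 - 1)) * (1 + y\<^sup>2) powr (max g 2 / 2 - 1/2)"
proof -
  let ?p = "max g 2" and ?H = "(1 + y\<^sup>2) powr (max g 2 / 2 - 1/2)" and ?r = "(1 + y\<^sup>2) powr (1/2)"
  have r: "1 \<le> ?r" "\<bar>y\<bar> \<le> ?r"
    using one_plus_square_powr_ge_1[of "1/2" y] abs_le_one_plus_square_powr[of 1 y] by auto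
  have "norm (x, y) \<le> \<bar>x\<bar> + \<bar>y\<bar>" using norm_Pair_le[of x y] by simp
  \<comment> \<open>The extra 1 makes the base at least 1, so that the exponent can be raised from
    \<open>g - 1\<close> to \<open>max g 2 - 1\<close>.\<close>
  then have n: "norm (x, y) \<le> 1 + m + 2 * \<bar>y\<bar>" using x by simp
  have "m * 1 \<le> m * ?r" using m r by (intro mult_left_mono) auto
  then have le: "1 + m + 2 * \<bar>y\<bar> \<le> (m + 3) * ?r" using r by (simp add: algebra_simps)
  have "norm (x, y) powr (g - 1) \<le> (1 + m + 2 * \<bar>y\<bar>) powr (g - 1)"
    using n g by (intro powr_mono2) auto
  also have "\<dots> \<le> (1 + m + 2 * \<bar>y\<bar>) powr (?p - 1)" using m by (intro powr_mono) auto
  also have "\<dots> \<le> ((m + 3) * ?r) powr (?p - 1)" using le m by (intro powr_mono2) auto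
  also have "\<dots> = (m + 3) powr (?p - 1) * ?r powr (?p - 1)" by (intro powr_mult)
  also have "?r powr (?p - 1) = ?H" by (simp add: powr_powr diff_divide_distrib)
  finally have "1 + norm (x, y) powr (g - 1) \<le> ?H + (m + 3) powr (?p - 1) * ?H"
    using one_plus_square_powr_ge_1[of "?p / 2 - 1/2" y] by (intro add_mono) auto
  also have "\<dots> = (1 + (m + 3) powr (?p - 1)) * ?H" by (simp add: algebra_simps)
  finally have "c * (1 + norm (x, y) powr (g - 1)) \<le> c * ((1 + (m + 3) powr (?p - 1)) * ?H)"
    using c(1) by (intro mult_left_mono) auto
  then show ?thesis using c(2)[of x y] by (simp add: mult.assoc)
qed

context bandit_moments
begin

text \<open>Both arguments of \<open>u\<close> share one source of randomness beyond the chosen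
  means: the average reward is the average chosen mean plus the innovations divided by
  \<open>n\<close>, which is the normalized sum divided by \<open>sqrt n\<close>.\<close>

lemma expected_utility_eq:
  fixes u :: "real \<times> real \<Rightarrow> real"
  assumes adm: "\<theta> \<in> admissible_strategies M K Y" and n: "n \<ge> 1" and u: "continuous_on UNIV u"
  shows "expected_utility M Y u n \<theta> = (\<integral>\<omega>. u (1 / n * (\<Sum>i=1..n. mean (\<theta> i \<omega>)) + normalized_sum \<theta> n \<omega> / sqrt n,
      normalized_sum \<theta> n \<omega>) \<partial>M)"
  unfolding expected_utility_def
proof (rule integral_cong_AE)
  have p: "predictable \<theta>" by (rule admissible_predictable[OF adm])
  have [measurable]: "u \<in> borel_measurable borel" using u by (rule borel_measurable_continuous_onI)
  have r [measurable]: "i \<in> {1..n} \<Longrightarrow> reward Y \<theta> i \<in> borel_measurable M" for i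
    using reward_measurable[OF p] by simp
  have mm [measurable]: "i \<in> {1..n} \<Longrightarrow> (\<lambda>\<omega>. mean (\<theta> i \<omega>)) \<in> borel_measurable M" for i
    using chosen_mean_measurable[OF p] by simp
  have [measurable]: "normalized_sum \<theta> n \<in> borel_measurable M" by (rule measurable_normalized_sum[OF p])
  have um: "(\<lambda>\<omega>. u (f \<omega>, h \<omega>)) \<in> borel_measurable M"
    if "f \<in> borel_measurable M" "h \<in> borel_measurable M" for f h
    using measurable_compose[OF borel_measurable_Pair[OF that], of u borel] by simp
  show "(\<lambda>\<omega>. u (1 / real n * (\<Sum>i=1..n. reward Y \<theta> i \<omega>),
        1 / sqrt (real n) * (\<Sum>i=1..n. reward Y \<theta> i \<omega>
            - real_cond_exp M (history M Y \<theta> (i - 1)) (reward Y \<theta> i) \<omega>))) \<in> borel_measurable M"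
    by (intro um borel_measurable_times borel_measurable_const borel_measurable_sum borel_measurable_diff
        borel_measurable_cond_exp2 r)
  show "(\<lambda>\<omega>. u (1 / n * (\<Sum>i=1..n. mean (\<theta> i \<omega>)) + normalized_sum \<theta> n \<omega> / sqrt n, normalized_sum \<theta> n \<omega>)) \<in> borel_measurable M"
    by (intro um borel_measurable_add borel_measurable_times borel_measurable_divide borel_measurable_const
        borel_measurable_sum mm) measurable
  have "AE \<omega> in M. \<forall>i\<in>{1..n}. real_cond_exp M (history M Y \<theta> (i - 1)) (reward Y \<theta> i) \<omega> = mean (\<theta> i \<omega>)"
    using cond_exp_reward[OF adm] by (intro AE_finite_allI) auto
  then show "AE \<omega> in M. u (1 / real n * (\<Sum>i=1..n. reward Y \<theta> i \<omega>),
        1 / sqrt (real n) * (\<Sum>i=1..n. reward Y \<theta> i \<omega>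
            - real_cond_exp M (history M Y \<theta> (i - 1)) (reward Y \<theta> i) \<omega>))
      = u (1 / n * (\<Sum>i=1..n. mean (\<theta> i \<omega>)) + normalized_sum \<theta> n \<omega> / sqrt n, normalized_sum \<theta> n \<omega>)"
  proof eventually_elim
    case (elim \<omega>)
    have c: "(\<Sum>i=1..n. reward Y \<theta> i \<omega>) = (\<Sum>i=1..n. mean (\<theta> i \<omega>)) + centred_sum \<theta> n \<omega>"
      by (simp add: centred_sum_def innovation_def reward_def flip: sum.distrib)
    have "(\<Sum>i=1..n. reward Y \<theta> i \<omega> - real_cond_exp M (history M Y \<theta> (i - 1)) (reward Y \<theta> i) \<omega>) = centred_sum \<theta> n \<omega>"
      using elim unfolding centred_sum_def by (intro sum.cong) (auto simp: innovation_def reward_def)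
    then show ?case using n by (simp add: c normalized_sum_def distrib_left)
  qed
qed

lemma expected_utility_bounds:
  fixes u :: "real \<times> real \<Rightarrow> real"
  assumes adm: "\<theta> \<in> admissible_strategies M K Y" and n: "n \<ge> 1" and u: "continuous_on UNIV u"
    and grow: "\<And>x y. \<bar>x\<bar> \<le> m + \<bar>y\<bar> \<Longrightarrow> \<bar>u (x, y)\<bar> \<le> C * (1 + y\<^sup>2) powr (q - 1/2)"
    and m: "\<And>k. k \<in> {1..K} \<Longrightarrow> \<bar>mean k\<bar> \<le> m" "\<bar>a\<bar> \<le> m"
  shows "\<lbrakk>\<And>y. mono (\<lambda>x. u (x, y)); \<And>k. k \<in> {1..K} \<Longrightarrow> mean k \<le> a\<rbrakk> \<Longrightarrow>
      expected_utility M Y u n \<theta> \<le> (\<integral>\<omega>. u (a + normalized_sum \<theta> n \<omega> / sqrt n, normalized_sum \<theta> n \<omega>) \<partial>M)"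
    and "\<lbrakk>\<And>i \<omega>. i \<ge> 1 \<Longrightarrow> \<omega> \<in> space M \<Longrightarrow> mean (\<theta> i \<omega>) = a\<rbrakk> \<Longrightarrow>
      expected_utility M Y u n \<theta> = (\<integral>\<omega>. u (a + normalized_sum \<theta> n \<omega> / sqrt n, normalized_sum \<theta> n \<omega>) \<partial>M)"
proof -
  let ?W = "normalized_sum \<theta> n"
  let ?a = "\<lambda>\<omega>. 1 / real n * (\<Sum>i=1..n. mean (\<theta> i \<omega>))"
  have p: "predictable \<theta>" by (rule admissible_predictable[OF adm])
  have [measurable]: "?W \<in> borel_measurable M" by (rule measurable_normalized_sum[OF p])
  have am [measurable]: "?a \<in> borel_measurable M"
    using chosen_mean_measurable[OF p] by (intro borel_measurable_times borel_measurable_sum) auto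
  have [measurable]: "u \<in> borel_measurable borel" using u by (rule borel_measurable_continuous_onI)
  have C: "C \<ge> 0" using grow[of 0 0] m(2) by fastforce
  have H: "integrable M (\<lambda>\<omega>. C * (1 + (?W \<omega>)\<^sup>2) powr (q - 1/2))"
    by (rule integrable_normalized_sum[OF p n, of "\<lambda>w. C * (1 + w\<^sup>2) powr (q - 1/2)" C])
      (use C in \<open>auto simp: growth_def\<close>)
  \<comment> \<open>Stated for any drift bounded by \<open>m\<close>, so that it covers the average
    of the chosen means and the constant \<open>a\<close> alike.\<close>
  have int: "integrable M (\<lambda>\<omega>. u (b \<omega> + ?W \<omega> / sqrt n, ?W \<omega>))"
    if b: "b \<in> borel_measurable M" "\<And>\<omega>. \<omega> \<in> space M \<Longrightarrow> \<bar>b \<omega>\<bar> \<le> m" for b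
  proof (rule Bochner_Integration.integrable_bound[OF H])
    have "(\<lambda>\<omega>. (b \<omega> + ?W \<omega> / sqrt n, ?W \<omega>)) \<in> borel_measurable M"
      using b(1) by (intro borel_measurable_Pair) auto
    from measurable_compose[OF this, of u borel]
    show "(\<lambda>\<omega>. u (b \<omega> + ?W \<omega> / sqrt n, ?W \<omega>)) \<in> borel_measurable M" by simp
    show "AE \<omega> in M. norm (u (b \<omega> + ?W \<omega> / sqrt n, ?W \<omega>)) \<le> norm (C * (1 + (?W \<omega>)\<^sup>2) powr (q - 1/2))"
    proof (rule AE_I2)
      fix \<omega> assume "\<omega> \<in> space M"
      have "\<bar>?W \<omega> / sqrt n\<bar> \<le> \<bar>?W \<omega>\<bar>" using n by (simp add: divide_le_eq mult_le_cancel_left1)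
      then have "\<bar>u (b \<omega> + ?W \<omega> / sqrt n, ?W \<omega>)\<bar> \<le> C * (1 + (?W \<omega>)\<^sup>2) powr (q - 1/2)"
        using b(2)[OF \<open>\<omega> \<in> space M\<close>] by (intro grow) linarith
      then show "norm (u (b \<omega> + ?W \<omega> / sqrt n, ?W \<omega>)) \<le> norm (C * (1 + (?W \<omega>)\<^sup>2) powr (q - 1/2))"
        using C by simp
    qed
  qed
  have a_le: "?a \<omega> \<le> b" if "\<And>i. i \<in> {1..n} \<Longrightarrow> mean (\<theta> i \<omega>) \<le> b" for b \<omega>
  proof -
    have "(\<Sum>i=1..n. mean (\<theta> i \<omega>)) \<le> real n * b"
      using sum_bounded_above[of "{1..n}" "\<lambda>i. mean (\<theta> i \<omega>)" b] that by simp
    then show ?thesis using n by (simp add: divide_le_eq mult.commute)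
  qed
  have a_ge: "b \<le> ?a \<omega>" if "\<And>i. i \<in> {1..n} \<Longrightarrow> b \<le> mean (\<theta> i \<omega>)" for b \<omega>
  proof -
    have "real n * b \<le> (\<Sum>i=1..n. mean (\<theta> i \<omega>))"
      using sum_bounded_below[of "{1..n}" b "\<lambda>i. mean (\<theta> i \<omega>)"] that by simp
    then show ?thesis using n by (simp add: le_divide_eq mult.commute)
  qed
  have arm: "\<theta> i \<omega> \<in> {1..K}" if "i \<in> {1..n}" "\<omega> \<in> space M" for i \<omega>
    using predictable_arm[OF p] that by auto
  have a_bd: "\<bar>?a \<omega>\<bar> \<le> m" if w: "\<omega> \<in> space M" for \<omega>
  proof -
    have "?a \<omega> \<le> m" using m(1)[OF arm[OF _ w]] by (intro a_le) (simp add: abs_le_iff)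
    moreover have "- m \<le> ?a \<omega>" using m(1)[OF arm[OF _ w]] by (intro a_ge) (fastforce simp: abs_le_iff)
    ultimately show ?thesis by linarith
  qed
  show "expected_utility M Y u n \<theta> \<le> (\<integral>\<omega>. u (a + ?W \<omega> / sqrt n, ?W \<omega>) \<partial>M)"
    if mono: "\<And>y. mono (\<lambda>x. u (x, y))" and le: "\<And>k. k \<in> {1..K} \<Longrightarrow> mean k \<le> a"
    unfolding expected_utility_eq[OF adm n u]
  proof (rule integral_mono)
    show "integrable M (\<lambda>\<omega>. u (?a \<omega> + ?W \<omega> / sqrt n, ?W \<omega>))" by (rule int[OF am a_bd])
    show "integrable M (\<lambda>\<omega>. u (a + ?W \<omega> / sqrt n, ?W \<omega>))" using m(2) by (intro int) auto
    fix \<omega> assume w: "\<omega> \<in> space M"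
    have "?a \<omega> \<le> a" using le[OF arm[OF _ w]] by (intro a_le)
    then show "u (?a \<omega> + ?W \<omega> / sqrt n, ?W \<omega>) \<le> u (a + ?W \<omega> / sqrt n, ?W \<omega>)"
      by (intro monoD[OF mono]) simp
  qed
  show "expected_utility M Y u n \<theta> = (\<integral>\<omega>. u (a + ?W \<omega> / sqrt n, ?W \<omega>) \<partial>M)"
    if eq: "\<And>i \<omega>. i \<ge> 1 \<Longrightarrow> \<omega> \<in> space M \<Longrightarrow> mean (\<theta> i \<omega>) = a"
    unfolding expected_utility_eq[OF adm n u]
    using eq n by (intro Bochner_Integration.integral_cong refl) simp
qed

text \<open>Adds three errors of size \<open>\<epsilon> / 3\<close>: removal of the drift,
  comparison with the arm \<open>k\<close>, and the central limit theorem for that arm. The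
  threshold \<open>n0\<close> precedes \<open>\<theta>\<close>, which is what permits the supremum
  over strategies later.\<close>

lemma expected_utility_limit:
  fixes u :: "real \<times> real \<Rightarrow> real"
  assumes u: "continuous_on UNIV u" "\<And>y. mono (\<lambda>x. u (x, y))" "\<And>x. concave_on UNIV (\<lambda>y. u (x, y))"
    and grow: "\<And>x y. \<bar>x\<bar> \<le> m + \<bar>y\<bar> \<Longrightarrow> \<bar>u (x, y)\<bar> \<le> C * (1 + y\<^sup>2) powr (q - 1/2)"
    and m: "\<And>k. k \<in> {1..K} \<Longrightarrow> \<bar>mean k\<bar> \<le> m"
    and k: "k \<in> {1..K}" "\<And>j. j \<in> {1..K} \<Longrightarrow> mean j \<le> mean k" "\<And>j. j \<in> {1..K} \<Longrightarrow> var k \<le> var j"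
    and "\<epsilon> > 0"
  defines "I \<equiv> \<integral>y. u (mean k, y) \<partial>centred_normal (var k)"
  shows "\<exists>n0. \<forall>n\<ge>n0. \<forall>\<theta>\<in>admissible_strategies M K Y. expected_utility M Y u n \<theta> \<le> I + \<epsilon> \<and>
    ((\<forall>i\<ge>1. \<forall>\<omega>\<in>space M. mean (\<theta> i \<omega>) = mean k \<and> var (\<theta> i \<omega>) = var k) \<longrightarrow>
      \<bar>expected_utility M Y u n \<theta> - I\<bar> \<le> \<epsilon>)"
proof -
  define f where "f y = u (mean k, y)" for y
  have fc: "continuous_on UNIV f"
    unfolding f_def[abs_def] by (intro continuous_on_compose2[OF u(1)] continuous_intros) auto
  have fg: "growth f C" unfolding growth_def f_def using m[OF k(1)] by (intro allI grow) simp
  define e where "e = \<epsilon> / 3"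
  have e: "e > 0" using \<open>\<epsilon> > 0\<close> by (simp add: e_def)
  have "(\<lambda>n. \<integral>\<omega>. f (normalized_sum (\<lambda>n \<omega>. k) n \<omega>) \<partial>M) \<longlonglongrightarrow> I"
    using clt_growth[OF k(1) fc fg] by (simp add: I_def f_def)
  from LIMSEQ_D[OF this e] obtain n1 where n1:
    "\<And>n. n \<ge> n1 \<Longrightarrow> \<bar>(\<integral>\<omega>. f (normalized_sum (\<lambda>n \<omega>. k) n \<omega>) \<partial>M) - I\<bar> < e" by auto
  obtain n2 where n2: "n2 \<ge> 1" "\<And>n t. \<lbrakk>n \<ge> n2; predictable t\<rbrakk> \<Longrightarrow>
      (\<integral>\<omega>. f (normalized_sum t n \<omega>) \<partial>M) \<le> (\<integral>\<omega>. f (normalized_sum (\<lambda>n \<omega>. k) n \<omega>) \<partial>M) + e"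
    "\<And>n t. \<lbrakk>n \<ge> n2; predictable t; \<forall>j\<ge>1. \<forall>\<omega>\<in>space M. var (t j \<omega>) = var k\<rbrakk> \<Longrightarrow>
      \<bar>(\<integral>\<omega>. f (normalized_sum t n \<omega>) \<partial>M) - (\<integral>\<omega>. f (normalized_sum (\<lambda>n \<omega>. k) n \<omega>) \<partial>M)\<bar> \<le> e"
    using concave_comparison[OF k(1) u(3)[of "mean k", folded f_def] fg e] k(3) by metis
  have "\<exists>n3\<ge>1. \<forall>n\<ge>n3. \<forall>t. predictable t \<longrightarrow>
      \<bar>(\<integral>\<omega>. u (mean k + normalized_sum t n \<omega> / sqrt n, normalized_sum t n \<omega>) \<partial>M)
        - (\<integral>\<omega>. f (normalized_sum t n \<omega>) \<partial>M)\<bar> \<le> e"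
    unfolding f_def by (rule drift_negligible[OF u(1) grow m[OF k(1)] e])
  then obtain n3 where n3: "\<forall>n\<ge>n3. \<forall>t. predictable t \<longrightarrow>
      \<bar>(\<integral>\<omega>. u (mean k + normalized_sum t n \<omega> / sqrt n, normalized_sum t n \<omega>) \<partial>M)
        - (\<integral>\<omega>. f (normalized_sum t n \<omega>) \<partial>M)\<bar> \<le> e"
    by blast
  show ?thesis
  proof (intro exI[of _ "max n1 (max n2 n3)"] allI impI ballI conjI)
    fix n \<theta> assume n: "max n1 (max n2 n3) \<le> n" and adm: "\<theta> \<in> admissible_strategies M K Y"
    have p: "predictable \<theta>" by (rule admissible_predictable[OF adm])
    have n_ge: "n \<ge> 1" "n \<ge> n1" "n \<ge> n2" "n \<ge> n3" using n n2(1) by auto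
    note bounds = expected_utility_bounds[OF adm n_ge(1) u(1), where m = m and C = C and a = "mean k"]
    have "expected_utility M Y u n \<theta>
        \<le> (\<integral>\<omega>. u (mean k + normalized_sum \<theta> n \<omega> / sqrt n, normalized_sum \<theta> n \<omega>) \<partial>M)"
      by (rule bounds(1)) (use grow m k u(2) in auto)
    then show "expected_utility M Y u n \<theta> \<le> I + \<epsilon>"
      using n1[OF n_ge(2)] n2(2)[OF n_ge(3) p] n3[rule_format, OF n_ge(4) p]
      unfolding e_def abs_le_iff abs_less_iff by linarith
    assume opt: "\<forall>i\<ge>1. \<forall>\<omega>\<in>space M. mean (\<theta> i \<omega>) = mean k \<and> var (\<theta> i \<omega>) = var k"
    then have "expected_utility M Y u n \<theta>
        = (\<integral>\<omega>. u (mean k + normalized_sum \<theta> n \<omega> / sqrt n, normalized_sum \<theta> n \<omega>) \<partial>M)"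
      by (intro bounds(2)) (use grow m k in auto)
    moreover have "\<bar>(\<integral>\<omega>. f (normalized_sum \<theta> n \<omega>) \<partial>M) - (\<integral>\<omega>. f (normalized_sum (\<lambda>n \<omega>. k) n \<omega>) \<partial>M)\<bar> \<le> e"
      using opt by (intro n2(3)[OF n_ge(3) p]) auto
    ultimately show "\<bar>expected_utility M Y u n \<theta> - I\<bar> \<le> \<epsilon>"
      using n1[OF n_ge(2)] n3[rule_format, OF n_ge(4) p]
      unfolding e_def abs_le_iff abs_less_iff by linarith
  qed
qed

end

text \<open>The second conjunct also covers strategies that switch between several arms with the
  optimal pair. Convergence is asserted separately because \<open>lim\<close> by itself makes no
  claim of existence.\<close>

theorem theorem2:
  fixes M :: "'a measure"
    and K :: nat
    and X :: "nat \<Rightarrow> 'a \<Rightarrow> real"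
    and Y :: "nat \<Rightarrow> nat \<Rightarrow> 'a \<Rightarrow> real"
    and u :: "real \<times> real \<Rightarrow> real"
    and \<mu>_max \<sigma>2_min :: real
  assumes "prob_space M"
    and "K \<ge> 1"
    and "\<And>k. k \<in> {1..K} \<Longrightarrow> integrable M (X k)"
    and "\<And>k. k \<in> {1..K} \<Longrightarrow> integrable M (\<lambda>\<omega>. (X k \<omega>)\<^sup>2)"
    and "\<And>k n. k \<in> {1..K} \<Longrightarrow> n \<ge> 1 \<Longrightarrow> distr M borel (Y k n) = distr M borel (X k)"
    and "prob_space.indep_vars M (\<lambda>_. borel) (\<lambda>(k, n). Y k n) ({1..K} \<times> {1..})"
    and "continuous_on UNIV u"
    and "\<exists>g\<ge>1. \<exists>c>0. (\<forall>x y. \<bar>u (x, y)\<bar> \<le> c * (1 + norm (x, y) powr (g - 1))) \<and>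
           (\<forall>k\<in>{1..K}. integrable M (\<lambda>\<omega>. \<bar>X k \<omega>\<bar> powr g))"
    and "\<mu>_max = Max (arm_mean M X ` {1..K})"
    and "\<sigma>2_min = Min (arm_var M X ` {1..K})"
    and "\<And>y. mono (\<lambda>x. u (x, y))"
    and "\<And>x. concave_on UNIV (\<lambda>y. u (x, y))"
    and "(\<mu>_max, \<sigma>2_min) \<in> mean_var_pairs M K X"
  shows "(\<forall>k\<in>{1..K}. (arm_mean M X k, arm_var M X k) = (\<mu>_max, \<sigma>2_min) \<longrightarrow>
            asymptotically_optimal M K Y u (\<lambda>n \<omega>. k))
       \<and> (\<forall>\<theta>\<in>admissible_strategies M K Y.
            (\<forall>n\<ge>1. \<forall>\<omega>\<in>space M.
               (arm_mean M X (\<theta> n \<omega>), arm_var M X (\<theta> n \<omega>)) = (\<mu>_max, \<sigma>2_min)) \<longrightarrow>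
            asymptotically_optimal M K Y u \<theta>)
       \<and> convergent (\<lambda>n. horizon_value M K Y u n)
       \<and> limit_value M K Y u = ereal (\<integral>y. u (\<mu>_max, y) \<partial>centred_normal \<sigma>2_min)"
proof -
  interpret prob_space M by fact
  interpret bandit M K X Y using assms(3-6) by unfold_locales auto
  obtain g c where g: "g \<ge> 1" "c > 0" "\<And>x y. \<bar>u (x, y)\<bar> \<le> c * (1 + norm (x, y) powr (g - 1))"
    "\<And>k. k \<in> {1..K} \<Longrightarrow> integrable M (\<lambda>\<omega>. \<bar>X k \<omega>\<bar> powr g)"
    using assms(8) by blast
  interpret bandit_moments M K X Y "max g 2 / 2"
    using centred_moments g(4) by unfold_locales auto
  define m where "m = (\<Sum>k\<in>{1..K}. \<bar>mean k\<bar>)"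
  have m0: "m \<ge> 0" unfolding m_def by (intro sum_nonneg) auto
  have m: "\<bar>mean k\<bar> \<le> m" if "k \<in> {1..K}" for k
    unfolding m_def using that by (intro member_le_sum) auto
  define I where "I = (\<integral>y. u (\<mu>_max, y) \<partial>centred_normal \<sigma>2_min)"
  \<comment> \<open>Here the membership assumption enters: one and the same arm attains the maximal
    mean and the minimal variance.\<close>
  obtain k where k: "k \<in> {1..K}" "mean k = \<mu>_max" "var k = \<sigma>2_min"
    using assms(13) by (auto simp: mean_var_pairs_def)
  have opt: "mean j \<le> mean k" "var k \<le> var j" if "j \<in> {1..K}" for j
    using that unfolding k(2,3) assms(9,10) by auto
  have close: "\<exists>n0. \<forall>n\<ge>n0. \<forall>\<theta>\<in>admissible_strategies M K Y. expected_utility M Y u n \<theta> \<le> I + \<epsilon> \<and>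
      ((\<forall>i\<ge>1. \<forall>\<omega>\<in>space M. mean (\<theta> i \<omega>) = \<mu>_max \<and> var (\<theta> i \<omega>) = \<sigma>2_min) \<longrightarrow>
        \<bar>expected_utility M Y u n \<theta> - I\<bar> \<le> \<epsilon>)" if "\<epsilon> > 0" for \<epsilon>
    using expected_utility_limit[OF assms(7,11,12) growth_bound_near_axis[OF g(1-3) m0] m k(1) opt that]
    unfolding k(2,3) I_def by blast
  have U: "(\<lambda>n. expected_utility M Y u n \<theta>) \<longlonglongrightarrow> I"
    if adm: "\<theta> \<in> admissible_strategies M K Y"
      and opt: "\<forall>i\<ge>1. \<forall>\<omega>\<in>space M. mean (\<theta> i \<omega>) = \<mu>_max \<and> var (\<theta> i \<omega>) = \<sigma>2_min" for \<theta>
  proof (rule LIMSEQ_I)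
    fix r :: real assume "r > 0"
    then have "r / 2 > 0" by simp
    from close[OF this] obtain n0 where n0: "\<And>n. n \<ge> n0 \<Longrightarrow> \<bar>expected_utility M Y u n \<theta> - I\<bar> \<le> r / 2"
      using adm opt by blast
    have "norm (expected_utility M Y u n \<theta> - I) < r" if "n \<ge> n0" for n
      using n0[OF that] \<open>r > 0\<close> by simp
    then show "\<exists>no. \<forall>n\<ge>no. norm (expected_utility M Y u n \<theta> - I) < r" by blast
  qed
  have H: "(\<lambda>n. horizon_value M K Y u n) \<longlonglongrightarrow> ereal I"
  proof (rule order_tendstoI)
    fix a :: ereal assume "a < ereal I"
    have "(\<lambda>n. ereal (expected_utility M Y u n (\<lambda>n \<omega>. k))) \<longlonglongrightarrow> ereal I"
      using U[OF const_admissible[OF k(1)]] k(2,3) by simp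
    from order_tendstoD(1)[OF this \<open>a < ereal I\<close>]
    show "\<forall>\<^sub>F n in sequentially. a < horizon_value M K Y u n"
    proof eventually_elim
      case (elim n)
      also have "ereal (expected_utility M Y u n (\<lambda>n \<omega>. k)) \<le> horizon_value M K Y u n"
        unfolding horizon_value_def by (rule SUP_upper[OF const_admissible[OF k(1)]])
      finally show ?case .
    qed
  next
    fix a :: ereal assume "ereal I < a"
    \<comment> \<open>A real number strictly in between is needed: \<open>a\<close> may be infinite,
      and a supremum preserves only weak inequalities.\<close>
    then obtain z where z: "ereal I < ereal z" "ereal z < a" using ereal_dense2 by blast
    then have "z - I > 0" by simp
    from close[OF this] obtain n0 where n0: "\<And>n \<theta>. \<lbrakk>n \<ge> n0; \<theta> \<in> admissible_strategies M K Y\<rbrakk>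
        \<Longrightarrow> expected_utility M Y u n \<theta> \<le> z" by auto
    have "horizon_value M K Y u n \<le> ereal z" if "n \<ge> n0" for n
      unfolding horizon_value_def using n0[OF that] by (intro SUP_least) simp
    then show "\<forall>\<^sub>F n in sequentially. horizon_value M K Y u n < a"
      using z(2) by (auto simp: eventually_sequentially intro: le_less_trans)
  qed
  then have L: "limit_value M K Y u = ereal I" unfolding limit_value_def by (rule limI)
  have ao: "asymptotically_optimal M K Y u \<theta>"
    if "\<theta> \<in> admissible_strategies M K Y"
      "\<forall>n\<ge>1. \<forall>\<omega>\<in>space M. (mean (\<theta> n \<omega>), var (\<theta> n \<omega>)) = (\<mu>_max, \<sigma>2_min)" for \<theta>
    unfolding asymptotically_optimal_def L using that U by simp
  show ?thesis
    using ao const_admissible L convergentI[OF H] unfolding I_def by simp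
qed

end
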